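(* Let $M\subset\mathbb{C}^N$ be a real-analytic generic submanifold with $0\in M$, of finite type at $0$. Let $M'\subset\mathbb{C}^{N'}$ be a real-analytic generic submanifold through $0$, let $\Sigma'_0$ be its Segre variety at $0$, and let $\tilde z\colon(\mathbb{C}^{N'},0)\to(\Sigma'_0,0)$ be a germ at $0$ of a holomorphic submersion such that $\tilde z^{-1}(0)$ is transversal to $\Sigma'_0$ at $0$. If $H\colon(\mathbb{C}^N,0)\to(\mathbb{C}^{N'},0)$ is a germ at $0$ of a holomorphic mapping such that $H(M)\subset M'$, then $H$ is uniquely determined by $\tilde z\circ H$; that is, if $H^1,H^2\colon(\mathbb{C}^N,0)\to(\mathbb{C}^{N'},0)$ are germs at $0$ of holomorphic mappings with $H^j(M)\subset M'$ for $j=1,2$ and $\tilde z\circ H^1=\tilde z\circ H^2$, then $H^1=H^2$.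
   Context: A real-analytic generic submanifold $M\subset\mathbb{C}^N$ of (real) codimension $d$ through $0$ is given near $0$ by $\rho_1(Z,\bar Z)=\dots=\rho_d(Z,\bar Z)=0$, where $\rho(Z,\zeta)=(\rho_1,\ldots,\rho_d)(Z,\zeta)$ is a $\mathbb{C}^d$-valued holomorphic function near $0\in\mathbb{C}^N\times\mathbb{C}^N$ with $\rho(Z,\zeta)=\overline{\rho(\bar\zeta,\bar Z)}$ and $\partial_Z\rho_1\wedge\cdots\wedge\partial_Z\rho_d\neq0$ near $0$. $M$ is of finite type at $p\in M$ (in the sense of Kohn and Bloom–Graham) if the complex Lie algebra $\mathfrak g_M$ generated by all smooth $(1,0)$ and $(0,1)$ vector fields tangent to $M$ satisfies $\mathfrak g_M(p)=\mathbb{C}T_pM$, the complexified tangent space of $M$ at $p$. For a sufficiently small neighborhood $U$ of $0$ and $p$ close to $0$, the Segre variety of $M$ at $p$ is $\Sigma_p:=\{Z\in U:\rho(Z,\bar p)=0\}$, a complex submanifold of dimension $N-d$. $\Sigma'_p$ denotes the Segre variety of $M'$. The inclusion $H(M)\subset M'$ is understood in the sense of germs at $0$. *)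

theory Defs
  imports "HOL-Analysis.Analysis"
begin

section \<open>Holomorphic maps of several variables\<close>

definition pair_scale :: "complex \<Rightarrow> (complex^'n) \<times> (complex^'n) \<Rightarrow> (complex^'n) \<times> (complex^'n)" where
  "pair_scale c p = (c *s fst p, c *s snd p)"

text \<open>The complex scalar multiplications of the source and of the target are passed as
  arguments, because there is no type class of complex normed spaces covering
  \<^typ>\<open>complex^'n\<close>, \<^typ>\<open>(complex^'n) \<times> (complex^'n)\<close> and \<^typ>\<open>complex\<close>.\<close>

definition holomorphic_map_on ::
  "(complex \<Rightarrow> 'a::real_normed_vector \<Rightarrow> 'a) \<Rightarrow> (complex \<Rightarrow> 'b::real_normed_vector \<Rightarrow> 'b)
    \<Rightarrow> ('a \<Rightarrow> 'b) \<Rightarrow> 'a set \<Rightarrow> bool" where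
  "holomorphic_map_on s1 s2 f S \<longleftrightarrow>
     (\<forall>x\<in>S. \<exists>f'. (f has_derivative f') (at x) \<and> Vector_Spaces.linear s1 s2 f')"

text \<open>A germ of a holomorphic map from (\<open>C^n\<close>, 0) to (\<open>C^m\<close>, 0) is represented by a total function,
  of which only the values near 0 matter.\<close>

definition holomorphic_germ :: "(complex^'n \<Rightarrow> complex^'m) \<Rightarrow> bool" where
  "holomorphic_germ f \<longleftrightarrow>
     (\<exists>S. open S \<and> 0 \<in> S \<and> holomorphic_map_on (*s) (*s) f S) \<and> f 0 = 0"

definition cnj_vec :: "complex^'n \<Rightarrow> complex^'n" where
  "cnj_vec Z = (\<chi> k. cnj (Z $ k))"

section \<open>Generic submanifolds and Segre varieties\<close>

text \<open>The value at \<open>(v 0, \<dots>, v (d-1))\<close> of the wedge product of the linear forms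
  \<open>\<alpha> 0, \<dots>, \<alpha> (d-1)\<close>.\<close>

definition wedge :: "nat \<Rightarrow> (nat \<Rightarrow> 'v \<Rightarrow> complex) \<Rightarrow> (nat \<Rightarrow> 'v) \<Rightarrow> complex" where
  "wedge d \<alpha> v = (\<Sum>\<pi> | \<pi> permutes {..<d}. of_int (sign \<pi>) * (\<Prod>i<d. \<alpha> (\<pi> i) (v i)))"

text \<open>The form \<open>\<partial>\<^sub>Z f\<close> at a point \<open>(Z, \<zeta>)\<close>, for \<open>f\<close> holomorphic in \<open>(Z, \<zeta>)\<close>.\<close>

definition dZ :: "((complex^'n) \<times> (complex^'n) \<Rightarrow> complex) \<Rightarrow> (complex^'n) \<times> (complex^'n)
    \<Rightarrow> complex^'n \<Rightarrow> complex" where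
  "dZ f q v = frechet_derivative f (at q) (v, 0)"

text \<open>\<open>M\<close> is given in the neighbourhood \<open>U\<close> of 0 by the equations \<open>\<rho> j (Z, cnj_vec Z) = 0\<close>, \<open>j < d\<close>.
  The defining functions are holomorphic on the neighbourhood \<open>U \<times> cnj_vec ` U\<close> of 0, which is
  invariant under \<open>(Z, \<zeta>) \<mapsto> (cnj_vec \<zeta>, cnj_vec Z)\<close>. Nothing is required of \<open>M\<close> outside \<open>U\<close>.\<close>

definition generic_submanifold ::
  "(complex^'n) set \<Rightarrow> nat \<Rightarrow> (nat \<Rightarrow> (complex^'n) \<times> (complex^'n) \<Rightarrow> complex)
    \<Rightarrow> (complex^'n) set \<Rightarrow> bool" where
  "generic_submanifold M d \<rho> U \<longleftrightarrow>
     open U \<and> 0 \<in> U \<and>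
     (\<forall>j<d. holomorphic_map_on pair_scale (*) (\<rho> j) (U \<times> cnj_vec ` U)) \<and>
     (\<forall>j<d. \<forall>Z\<in>U. \<forall>\<zeta>\<in>cnj_vec ` U. \<rho> j (Z, \<zeta>) = cnj (\<rho> j (cnj_vec \<zeta>, cnj_vec Z))) \<and>
     (\<forall>Z\<in>U. \<forall>\<zeta>\<in>cnj_vec ` U. wedge d (\<lambda>j. dZ (\<rho> j) (Z, \<zeta>)) \<noteq> (\<lambda>v. 0)) \<and>
     M \<inter> U = {Z\<in>U. \<forall>j<d. \<rho> j (Z, cnj_vec Z) = 0}"

definition segre ::
  "nat \<Rightarrow> (nat \<Rightarrow> (complex^'n) \<times> (complex^'n) \<Rightarrow> complex) \<Rightarrow> (complex^'n) set \<Rightarrow> complex^'n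
    \<Rightarrow> (complex^'n) set" where
  "segre d \<rho> U p = {Z\<in>U. \<forall>j<d. \<rho> j (Z, cnj_vec p) = 0}"

text \<open>The holomorphic tangent space at \<open>Z\<close> of the Segre variety at \<open>p\<close>, for \<open>Z \<in> segre d \<rho> U p\<close>.\<close>

definition segre_tangent ::
  "nat \<Rightarrow> (nat \<Rightarrow> (complex^'n) \<times> (complex^'n) \<Rightarrow> complex) \<Rightarrow> complex^'n \<Rightarrow> complex^'n
    \<Rightarrow> (complex^'n) set" where
  "segre_tangent d \<rho> p Z = {v. \<forall>j<d. dZ (\<rho> j) (Z, cnj_vec p) v = 0}"

section \<open>Complex vector fields and finite type\<close>

text \<open>The pair \<open>(a, b)\<close> stands for the complexified tangent vector
  \<open>\<Sum>k. a$k \<partial>/\<partial>Z\<^sub>k + b$k \<partial>/\<partial>Zbar\<^sub>k\<close> of \<open>C^n\<close>; a vector field is a function with such values. Type (1,0)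
  means \<open>b = 0\<close> and type (0,1) means \<open>a = 0\<close>.\<close>

type_synonym 'n vfield = "complex^'n \<Rightarrow> (complex^'n) \<times> (complex^'n)"

definition d_Z :: "'n::finite \<Rightarrow> (complex^'n \<Rightarrow> complex) \<Rightarrow> complex^'n \<Rightarrow> complex" where
  "d_Z k f Z = (frechet_derivative f (at Z) (axis k 1)
                - \<i> * frechet_derivative f (at Z) (axis k \<i>)) / 2"

definition d_Zbar :: "'n::finite \<Rightarrow> (complex^'n \<Rightarrow> complex) \<Rightarrow> complex^'n \<Rightarrow> complex" where
  "d_Zbar k f Z = (frechet_derivative f (at Z) (axis k 1)
                   + \<i> * frechet_derivative f (at Z) (axis k \<i>)) / 2"

definition vf_apply :: "('n::finite) vfield \<Rightarrow> (complex^'n \<Rightarrow> complex) \<Rightarrow> complex^'n \<Rightarrow> complex" where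
  "vf_apply X f Z = (\<Sum>k\<in>UNIV. fst (X Z) $ k * d_Z k f Z + snd (X Z) $ k * d_Zbar k f Z)"

definition lie_bracket :: "('n::finite) vfield \<Rightarrow> 'n vfield \<Rightarrow> 'n vfield" where
  "lie_bracket X Y = (\<lambda>Z.
     (\<chi> k. vf_apply X (\<lambda>W. fst (Y W) $ k) Z - vf_apply Y (\<lambda>W. fst (X W) $ k) Z,
      \<chi> k. vf_apply X (\<lambda>W. snd (Y W) $ k) Z - vf_apply Y (\<lambda>W. snd (X W) $ k) Z))"

primrec times_differentiable_on ::
  "nat \<Rightarrow> ('a::real_normed_vector \<Rightarrow> 'b::real_normed_vector) \<Rightarrow> 'a set \<Rightarrow> bool" where
  "times_differentiable_on 0 f S \<longleftrightarrow> continuous_on S f"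
| "times_differentiable_on (Suc n) f S \<longleftrightarrow>
     (\<forall>x\<in>S. f differentiable (at x)) \<and>
     (\<forall>v. times_differentiable_on n (\<lambda>x. frechet_derivative f (at x) v) S)"

definition smooth_on :: "('a::real_normed_vector \<Rightarrow> 'b::real_normed_vector) \<Rightarrow> 'a set \<Rightarrow> bool" where
  "smooth_on f S \<longleftrightarrow> (\<forall>n. times_differentiable_on n f S)"

text \<open>The complexified tangent space of \<open>M\<close> at \<open>Z\<close>: the vectors that annihilate the functions
  \<open>Z \<mapsto> \<rho> j (Z, cnj_vec Z)\<close>. By the chain rule, \<open>(a, b)\<close> maps this function to the derivative of
  \<open>\<rho> j\<close> in the direction \<open>(a, b)\<close>.\<close>

definition complex_tangent ::
  "nat \<Rightarrow> (nat \<Rightarrow> (complex^'n) \<times> (complex^'n) \<Rightarrow> complex) \<Rightarrow> complex^'n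
    \<Rightarrow> ((complex^'n) \<times> (complex^'n)) set" where
  "complex_tangent d \<rho> Z =
     {w. \<forall>j<d. frechet_derivative (\<rho> j) (at (Z, cnj_vec Z)) w = 0}"

text \<open>Smooth vector fields on \<open>M\<close> near \<open>p\<close> are represented by smooth extensions to a neighbourhood of
  \<open>p\<close> in \<open>C^n\<close>; tangency and type are only required at the points of \<open>M\<close>. On \<open>M\<close>, the bracket of two
  fields tangent to \<open>M\<close> does not depend on the extensions.\<close>

definition tangent_field_near ::
  "(complex^'n) set \<Rightarrow> nat \<Rightarrow> (nat \<Rightarrow> (complex^'n) \<times> (complex^'n) \<Rightarrow> complex)
    \<Rightarrow> complex^'n \<Rightarrow> ((complex^'n) \<times> (complex^'n)) set \<Rightarrow> ('n::finite) vfield \<Rightarrow> bool" where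
  "tangent_field_near M d \<rho> p T X \<longleftrightarrow>
     (\<exists>V. open V \<and> p \<in> V \<and> smooth_on X V \<and>
          (\<forall>Z\<in>M \<inter> V. X Z \<in> complex_tangent d \<rho> Z \<inter> T))"

inductive_set lie_algebra ::
  "(complex^'n) set \<Rightarrow> nat \<Rightarrow> (nat \<Rightarrow> (complex^'n) \<times> (complex^'n) \<Rightarrow> complex)
    \<Rightarrow> complex^'n \<Rightarrow> ('n::finite) vfield set"
  for M d \<rho> p where
  type_10: "tangent_field_near M d \<rho> p {w. snd w = 0} X \<Longrightarrow> X \<in> lie_algebra M d \<rho> p"
| type_01: "tangent_field_near M d \<rho> p {w. fst w = 0} X \<Longrightarrow> X \<in> lie_algebra M d \<rho> p"
| add: "X \<in> lie_algebra M d \<rho> p \<Longrightarrow> Y \<in> lie_algebra M d \<rho> p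
    \<Longrightarrow> (\<lambda>Z. X Z + Y Z) \<in> lie_algebra M d \<rho> p"
| scale: "X \<in> lie_algebra M d \<rho> p \<Longrightarrow> (\<lambda>Z. pair_scale c (X Z)) \<in> lie_algebra M d \<rho> p"
| bracket: "X \<in> lie_algebra M d \<rho> p \<Longrightarrow> Y \<in> lie_algebra M d \<rho> p
    \<Longrightarrow> lie_bracket X Y \<in> lie_algebra M d \<rho> p"

definition finite_type_at ::
  "(complex^'n) set \<Rightarrow> nat \<Rightarrow> (nat \<Rightarrow> (complex^'n) \<times> (complex^'n) \<Rightarrow> complex)
    \<Rightarrow> complex^'n \<Rightarrow> bool" where
  "finite_type_at M d \<rho> p \<longleftrightarrow> (\<lambda>X. X p) ` lie_algebra M d \<rho> p = complex_tangent d \<rho> p"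

end

theory Submission
  imports Defs "HOL-Complex_Analysis.Cauchy_Integral_Formula"
begin

text \<open>Write \<open>h = H1 - H2\<close>. The functions \<open>zt\<close> and \<open>\<rho>' j (\<cdot>, 0)\<close> together form local coordinates of the
  target: the differential of \<open>zt\<close> maps the tangent space of the Segre variety onto itself, and the
  \<open>\<rho>' j\<close> measure the remaining directions. A suitable linear combination \<open>\<Theta>\<close> of the components of
  \<open>zt\<close> and of the \<open>\<rho>' j\<close> has the identity as its \<open>Z\<close>-differential at 0 (\<open>target_coordinates\<close>). On
  \<open>M\<close> both maps give the same value of \<open>\<Theta>\<close>, because \<open>zt \<circ> H1 = zt \<circ> H2\<close> and \<open>\<rho>'\<close> vanishes on
  \<open>M'\<close>. Hadamard's lemma turns this into a reflection identity \<open>P h + R hbar = 0\<close> on \<open>M\<close> with smooth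
  matrices \<open>P\<close>, \<open>R\<close> and \<open>P\<close> the identity at 0 (\<open>hadamard_difference\<close>).

  Tangential fields of type \<open>(0,1)\<close> annihilate \<open>h\<close> on \<open>M\<close>, and those of type \<open>(1,0)\<close> annihilate its
  conjugate. If \<open>X\<close> is of type \<open>(1,0)\<close>, applying it to the reflection identity expresses \<open>P (X h)\<close> by
  \<open>h\<close> and \<open>hbar\<close> without further derivatives, and the conjugate identity does the same for fields of
  type \<open>(0,1)\<close>. As \<open>h\<close> vanishes at 0, induction on the number of fields shows that every iterated
  derivative \<open>X\<^sub>1 \<dots> X\<^sub>k h\<close> along such fields vanishes at 0 (\<open>flat_of_reflection\<close>). Since a Lie
  bracket acts as a commutator, the same holds for fields of the Lie algebra
  (\<open>flat_vf_apply_lie_algebra\<close>).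

  By finite type the Lie algebra contains fields whose \<open>(1,0)\<close> parts at 0 are the coordinate vectors,
  and on holomorphic functions only the \<open>(1,0)\<close> parts act. So all derivatives \<open>\<partial>h/\<partial>Z\<^sub>k\<close> inherit the
  vanishing of the iterated derivatives (\<open>flat_d_Z\<close>), and then so do all higher derivatives. Hence
  the Taylor series of \<open>h\<close> at 0 is zero (\<open>flat_holomorphic_zero\<close>).

  That fields tangent to \<open>M\<close> preserve the functions vanishing on \<open>M\<close> follows from a local
  straightening of \<open>M\<close> (\<open>real_tangent_derivative_zero\<close>).\<close>

section \<open>Calculus of smooth functions\<close>

lemma frechet_derivative_eqI:
  "(f has_derivative f') (at x) \<Longrightarrow> frechet_derivative f (at x) = f'"
  using frechet_derivative_at by metis

lemma times_differentiable_on_cong: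
  assumes "open S" "\<And>x. x \<in> S \<Longrightarrow> f x = g x" "times_differentiable_on n f S"
  shows "times_differentiable_on n g S"
  using assms(2,3)
proof (induction n arbitrary: f g)
  case 0
  then show ?case
    by (metis continuous_on_cong times_differentiable_on.simps(1))
next
  case (Suc n)
  have deriv: "(g has_derivative frechet_derivative f (at x)) (at x)" if "x \<in> S" for x
  proof (rule has_derivative_transform_within_open[OF _ \<open>open S\<close> that])
    show "(f has_derivative frechet_derivative f (at x)) (at x)"
      using Suc.prems(2) that by (simp add: frechet_derivative_works[symmetric])
  qed (use Suc.prems(1) in auto)
  then have "frechet_derivative g (at x) = frechet_derivative f (at x)" if "x \<in> S" for x
    using that by (intro frechet_derivative_eqI)
  then have "times_differentiable_on n (\<lambda>x. frechet_derivative g (at x) v) S" for v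
    using Suc.IH[of "\<lambda>x. frechet_derivative f (at x) v" "\<lambda>x. frechet_derivative g (at x) v"]
      Suc.prems by auto
  then show ?case
    using deriv unfolding times_differentiable_on.simps differentiable_def by blast
qed

lemma times_differentiable_on_SucD:
  "times_differentiable_on (Suc n) f S \<Longrightarrow> times_differentiable_on n f S"
proof (induction n arbitrary: f)
  case 0
  then show ?case
    by (metis continuous_at_imp_continuous_on differentiable_imp_continuous_within
        times_differentiable_on.simps)
next
  case (Suc n)
  then show ?case by (metis times_differentiable_on.simps(2))
qed

lemma times_differentiable_on_subset:
  "times_differentiable_on n f S \<Longrightarrow> T \<subseteq> S \<Longrightarrow> times_differentiable_on n f T"
  by (induction n arbitrary: f) (auto intro: continuous_on_subset)

lemma times_differentiable_on_const: "times_differentiable_on n (\<lambda>x. c) S"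
  by (induction n arbitrary: c) (auto simp: frechet_derivative_const)

lemma frechet_derivative_add:
  assumes "f differentiable (at x)" "g differentiable (at x)"
  shows "frechet_derivative (\<lambda>y. f y + g y) (at x)
    = (\<lambda>v. frechet_derivative f (at x) v + frechet_derivative g (at x) v)"
  using assms unfolding frechet_derivative_works
  by (rule frechet_derivative_eqI[OF has_derivative_add])

lemma times_differentiable_on_add:
  assumes "open S" "times_differentiable_on n f S" "times_differentiable_on n g S"
  shows "times_differentiable_on n (\<lambda>x. f x + g x) S"
  using assms(2,3)
proof (induction n arbitrary: f g)
  case 0
  then show ?case by (auto intro: continuous_on_add)
next
  case (Suc n)
  have "times_differentiable_on n (\<lambda>x. frechet_derivative (\<lambda>y. f y + g y) (at x) v) S" for v
    by (rule times_differentiable_on_cong[OF \<open>open S\<close> _ Suc.IH[of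
        "\<lambda>x. frechet_derivative f (at x) v" "\<lambda>x. frechet_derivative g (at x) v"]])
      (use Suc.prems in \<open>simp_all add: frechet_derivative_add\<close>)
  moreover have "(\<lambda>x. f x + g x) differentiable (at x)" if "x \<in> S" for x
    using Suc.prems that by simp
  ultimately show ?case by simp
qed

lemma frechet_derivative_bounded_linear_comp:
  assumes "bounded_linear L" "f differentiable (at x)"
  shows "frechet_derivative (\<lambda>y. L (f y)) (at x) = (\<lambda>v. L (frechet_derivative f (at x) v))"
  by (rule frechet_derivative_eqI, rule bounded_linear.has_derivative[OF assms(1)])
    (use assms(2) frechet_derivative_works in blast)

lemma times_differentiable_on_bounded_linear:
  assumes "open S" "bounded_linear L" "times_differentiable_on n f S"
  shows "times_differentiable_on n (\<lambda>x. L (f x)) S"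
  using assms(3)
proof (induction n arbitrary: f)
  case 0
  then show ?case using assms(2) by (auto intro: bounded_linear.continuous_on)
next
  case (Suc n)
  have "times_differentiable_on n (\<lambda>x. frechet_derivative (\<lambda>y. L (f y)) (at x) v) S" for v
    by (rule times_differentiable_on_cong[OF \<open>open S\<close> _ Suc.IH[of
        "\<lambda>x. frechet_derivative f (at x) v"]])
      (use Suc.prems in \<open>simp_all add: frechet_derivative_bounded_linear_comp[OF assms(2)]\<close>)
  moreover have "(\<lambda>x. L (f x)) differentiable (at x)" if "x \<in> S" for x
    using bounded_linear.has_derivative[OF assms(2)] Suc.prems that
    unfolding times_differentiable_on.simps differentiable_def by blast
  ultimately show ?case by auto
qed

lemma frechet_derivative_mult_complex:
  fixes f g :: "'a::real_normed_vector \<Rightarrow> complex"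
  assumes "f differentiable (at x)" "g differentiable (at x)"
  shows "frechet_derivative (\<lambda>y. f y * g y) (at x)
    = (\<lambda>v. f x * frechet_derivative g (at x) v + frechet_derivative f (at x) v * g x)"
  using assms unfolding frechet_derivative_works
  by (rule frechet_derivative_eqI[OF has_derivative_mult])

lemma times_differentiable_on_mult:
  fixes f g :: "'a::real_normed_vector \<Rightarrow> complex"
  assumes "open S" "times_differentiable_on n f S" "times_differentiable_on n g S"
  shows "times_differentiable_on n (\<lambda>x. f x * g x) S"
  using assms(2,3)
proof (induction n arbitrary: f g)
  case 0
  then show ?case by (auto intro: continuous_on_mult)
next
  case (Suc n)
  have less: "times_differentiable_on n f S" "times_differentiable_on n g S"
    using Suc.prems times_differentiable_on_SucD by blast+
  have "times_differentiable_on n (\<lambda>x. frechet_derivative (\<lambda>y. f y * g y) (at x) v) S" for v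
  proof (rule times_differentiable_on_cong[OF \<open>open S\<close>])
    show "times_differentiable_on n (\<lambda>x. f x * frechet_derivative g (at x) v
        + frechet_derivative f (at x) v * g x) S"
      using Suc less by (intro times_differentiable_on_add[OF \<open>open S\<close>]) auto
  qed (use Suc.prems in \<open>simp add: frechet_derivative_mult_complex\<close>)
  moreover have "(\<lambda>x. f x * g x) differentiable (at x)" if "x \<in> S" for x
    using Suc.prems that by simp
  ultimately show ?case by simp
qed

lemma times_differentiable_on_linear_precomp:
  assumes "open S" "bounded_linear L" "times_differentiable_on n f T" "L ` S \<subseteq> T"
  shows "times_differentiable_on n (\<lambda>x. f (L x)) S"
  using assms(3)
proof (induction n arbitrary: f)
  case 0
  then show ?case
    using continuous_on_compose2[of T f S L] assms(2,4) by (auto simp: linear_continuous_on)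
next
  case (Suc n)
  have deriv: "((\<lambda>x. f (L x)) has_derivative (\<lambda>v. frechet_derivative f (at (L x)) (L v))) (at x)"
    if "x \<in> S" for x
  proof -
    have "(f has_derivative frechet_derivative f (at (L x))) (at (L x))"
      using Suc.prems that assms(4) frechet_derivative_works by auto
    then show ?thesis
      using has_derivative_compose[of L L x UNIV f] bounded_linear_imp_has_derivative[OF assms(2)]
      by blast
  qed
  have "times_differentiable_on n (\<lambda>x. frechet_derivative (\<lambda>y. f (L y)) (at x) v) S" for v
    by (rule times_differentiable_on_cong[OF \<open>open S\<close> _ Suc.IH[of
        "\<lambda>x. frechet_derivative f (at x) (L v)"]])
      (use Suc.prems in \<open>auto simp: frechet_derivative_at[OF deriv, symmetric]\<close>)
  then show ?case
    using deriv unfolding times_differentiable_on.simps differentiable_def by blast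
qed

text \<open>The second difference of \<open>f\<close> over a small parallelogram with sides \<open>s v\<close>, \<open>s w\<close> equals, by
  two applications of the mean value theorem, \<open>s\<^sup>2\<close> times a mixed derivative at a nearby point.\<close>

lemma second_difference_mean_value:
  fixes f :: "'a::real_normed_vector \<Rightarrow> real"
  assumes "0 < s"
    and "\<And>a b. 0 \<le> a \<Longrightarrow> a \<le> s \<Longrightarrow> 0 \<le> b \<Longrightarrow> b \<le> s \<Longrightarrow> x + a *\<^sub>R v + b *\<^sub>R w \<in> S"
    and diff: "\<And>y. y \<in> S \<Longrightarrow> f differentiable (at y)"
      "\<And>y. y \<in> S \<Longrightarrow> (\<lambda>y. frechet_derivative f (at y) v) differentiable (at y)"
  obtains a b where "0 \<le> a" "a \<le> s" "0 \<le> b" "b \<le> s"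
    "f (x + s *\<^sub>R v + s *\<^sub>R w) - f (x + s *\<^sub>R v) - f (x + s *\<^sub>R w) + f x
      = s\<^sup>2 * frechet_derivative (\<lambda>y. frechet_derivative f (at y) v) (at (x + a *\<^sub>R v + b *\<^sub>R w)) w"
proof -
  have line: "((\<lambda>t. g (p + t *\<^sub>R u)) has_derivative (\<lambda>t. t * frechet_derivative g (at (p + t0 *\<^sub>R u)) u)) (at t0)"
    if "g differentiable (at (p + t0 *\<^sub>R u))" for g :: "'a \<Rightarrow> real" and p u t0
  proof -
    have "((\<lambda>t. p + t *\<^sub>R u) has_derivative (\<lambda>t. t *\<^sub>R u)) (at t0)"
      by (auto intro!: derivative_eq_intros)
    from has_derivative_compose[OF this] frechet_derivative_works[THEN iffD1, OF that]
    have "((\<lambda>t. g (p + t *\<^sub>R u)) has_derivative (\<lambda>t. frechet_derivative g (at (p + t0 *\<^sub>R u)) (t *\<^sub>R u))) (at t0)"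
      by blast
    then show ?thesis
      using linear_frechet_derivative[OF that] by (simp add: linear_scale)
  qed
  define D where "D = (\<lambda>y. frechet_derivative f (at y) v)"
  define g where "g = (\<lambda>a. f (x + s *\<^sub>R w + a *\<^sub>R v) - f (x + a *\<^sub>R v))"
  have g: "(g has_derivative (\<lambda>t. t * (D (x + s *\<^sub>R w + a *\<^sub>R v) - D (x + a *\<^sub>R v)))) (at a)"
    if "0 \<le> a" "a \<le> s" for a
  proof -
    have "x + s *\<^sub>R w + a *\<^sub>R v \<in> S" "x + a *\<^sub>R v \<in> S"
      using assms(2)[of a s] assms(2)[of a 0] that \<open>0 < s\<close> by (auto simp: algebra_simps)
    then show ?thesis
      unfolding g_def D_def right_diff_distrib by (intro has_derivative_diff line diff)
  qed
  obtain a where a: "0 < a" "a < s" "g s - g 0 = s * (D (x + s *\<^sub>R w + a *\<^sub>R v) - D (x + a *\<^sub>R v))"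
    using mvt[OF \<open>0 < s\<close>, of g "\<lambda>a t. t * (D (x + s *\<^sub>R w + a *\<^sub>R v) - D (x + a *\<^sub>R v))"]
      g has_derivative_continuous_on[of "{0..s}" g] has_derivative_at_withinI
    by (smt (verit) atLeastAtMost_iff diff_zero)
  define k where "k = (\<lambda>b. D (x + a *\<^sub>R v + b *\<^sub>R w))"
  have k: "(k has_derivative (\<lambda>t. t * frechet_derivative D (at (x + a *\<^sub>R v + b *\<^sub>R w)) w)) (at b)"
    if "0 \<le> b" "b \<le> s" for b
    unfolding k_def using diff(2) assms(2)[of a b] that a unfolding D_def[symmetric]
    by (intro line) auto
  obtain b where b: "0 < b" "b < s"
    "k s - k 0 = s * frechet_derivative D (at (x + a *\<^sub>R v + b *\<^sub>R w)) w"
    using mvt[OF \<open>0 < s\<close>, of k "\<lambda>b t. t * frechet_derivative D (at (x + a *\<^sub>R v + b *\<^sub>R w)) w"]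
      k has_derivative_continuous_on[of "{0..s}" k] has_derivative_at_withinI
    by (smt (verit) atLeastAtMost_iff diff_zero)
  have "g s - g 0 = s\<^sup>2 * frechet_derivative D (at (x + a *\<^sub>R v + b *\<^sub>R w)) w"
    using a(3) b(3) by (simp add: k_def power2_eq_square algebra_simps)
  then show ?thesis
    using that[of a b] a b by (simp add: g_def D_def algebra_simps)
qed

lemma second_derivative_symmetric_real:
  fixes f :: "'a::real_normed_vector \<Rightarrow> real"
  assumes "open S" "x \<in> S" "times_differentiable_on 2 f S"
  shows "frechet_derivative (\<lambda>y. frechet_derivative f (at y) v) (at x) w
    = frechet_derivative (\<lambda>y. frechet_derivative f (at y) w) (at x) v"
proof (rule ccontr)
  define P where "P = (\<lambda>v w y. frechet_derivative (\<lambda>y. frechet_derivative f (at y) v) (at y) w)"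
  assume neq: "\<not> ?thesis"
  define e where "e = \<bar>P v w x - P w v x\<bar> / 2"
  have "e > 0" using neq by (simp add: e_def P_def)
  have cont: "continuous_on S (P v w)" for v w
    using assms(3) by (auto simp: numeral_2_eq_2 P_def)
  have diff: "f differentiable (at y)" "(\<lambda>y. frechet_derivative f (at y) v) differentiable (at y)"
    if "y \<in> S" for y v
    using assms(3) that by (auto simp: numeral_2_eq_2)
  have near: "\<exists>\<delta>>0. \<forall>y. dist y x < \<delta> \<longrightarrow> y \<in> S \<and> dist (P v w y) (P v w x) < e" for v w
  proof -
    have "isCont (P v w) x"
      using cont assms(1,2) continuous_on_eq_continuous_at by blast
    then obtain \<delta>1 where "\<delta>1 > 0" "\<And>y. dist y x < \<delta>1 \<Longrightarrow> dist (P v w y) (P v w x) < e"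
      using \<open>e > 0\<close> unfolding continuous_at_eps_delta by blast
    moreover obtain \<delta>2 where "\<delta>2 > 0" "\<And>y. dist y x < \<delta>2 \<Longrightarrow> y \<in> S"
      using assms(1,2) open_dist by blast
    ultimately show ?thesis
      by (intro exI[of _ "min \<delta>1 \<delta>2"]) auto
  qed
  obtain \<delta>1 where \<delta>1: "\<delta>1 > 0" "\<And>y. dist y x < \<delta>1 \<Longrightarrow> y \<in> S \<and> dist (P v w y) (P v w x) < e"
    using near by blast
  obtain \<delta>2 where \<delta>2: "\<delta>2 > 0" "\<And>y. dist y x < \<delta>2 \<Longrightarrow> y \<in> S \<and> dist (P w v y) (P w v x) < e"
    using near by blast
  define s where "s = min \<delta>1 \<delta>2 / (2 * (norm v + norm w + 1))"
  have "s > 0" using \<delta>1 \<delta>2 by (simp add: s_def add_nonneg_pos)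
  have close: "dist (x + a *\<^sub>R v + b *\<^sub>R w) x < min \<delta>1 \<delta>2"
    if "0 \<le> a" "a \<le> s" "0 \<le> b" "b \<le> s" for a b
  proof -
    have "norm (a *\<^sub>R v + b *\<^sub>R w) \<le> a * norm v + b * norm w"
      using norm_triangle_ineq[of "a *\<^sub>R v" "b *\<^sub>R w"] that by simp
    also have "\<dots> \<le> s * norm v + s * norm w"
      using that by (intro add_mono mult_right_mono) auto
    also have "\<dots> < s * (2 * (norm v + norm w + 1))"
      using \<open>s > 0\<close> by (simp add: algebra_simps add_pos_nonneg add_strict_increasing)
    also have "\<dots> = min \<delta>1 \<delta>2"
      unfolding s_def using norm_ge_zero[of v] norm_ge_zero[of w] by (simp add: add_nonneg_eq_0_iff)
    finally show ?thesis by (simp add: dist_norm add.assoc)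
  qed
  obtain a b where ab: "0 \<le> a" "a \<le> s" "0 \<le> b" "b \<le> s"
    "f (x + s *\<^sub>R v + s *\<^sub>R w) - f (x + s *\<^sub>R v) - f (x + s *\<^sub>R w) + f x = s\<^sup>2 * P v w (x + a *\<^sub>R v + b *\<^sub>R w)"
  proof (rule second_difference_mean_value[OF \<open>s > 0\<close>, of x v w S f])
    show "x + a *\<^sub>R v + b *\<^sub>R w \<in> S" if "0 \<le> a" "a \<le> s" "0 \<le> b" "b \<le> s" for a b
      using close[OF that] \<delta>1(2) by simp
  qed (use diff in \<open>auto simp: P_def\<close>)
  have close': "dist (x + a *\<^sub>R w + b *\<^sub>R v) x < min \<delta>1 \<delta>2"
    if "0 \<le> a" "a \<le> s" "0 \<le> b" "b \<le> s" for a b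
    using close[of b a] that by (simp add: algebra_simps)
  obtain a' b' where ab': "0 \<le> a'" "a' \<le> s" "0 \<le> b'" "b' \<le> s"
    "f (x + s *\<^sub>R w + s *\<^sub>R v) - f (x + s *\<^sub>R w) - f (x + s *\<^sub>R v) + f x = s\<^sup>2 * P w v (x + a' *\<^sub>R w + b' *\<^sub>R v)"
  proof (rule second_difference_mean_value[OF \<open>s > 0\<close>, of x w v S f])
    show "x + a *\<^sub>R w + b *\<^sub>R v \<in> S" if "0 \<le> a" "a \<le> s" "0 \<le> b" "b \<le> s" for a b
      using close'[OF that] \<delta>1(2) by simp
  qed (use diff in \<open>auto simp: P_def\<close>)
  have "s\<^sup>2 * P v w (x + a *\<^sub>R v + b *\<^sub>R w) = s\<^sup>2 * P w v (x + a' *\<^sub>R w + b' *\<^sub>R v)"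
    using ab(5) ab'(5) by (simp add: algebra_simps)
  then have "P v w (x + a *\<^sub>R v + b *\<^sub>R w) = P w v (x + a' *\<^sub>R w + b' *\<^sub>R v)"
    using \<open>s > 0\<close> by simp
  moreover have "dist (P v w (x + a *\<^sub>R v + b *\<^sub>R w)) (P v w x) < e"
    using close ab \<delta>1 by auto
  moreover have "dist (P w v (x + a' *\<^sub>R w + b' *\<^sub>R v)) (P w v x) < e"
    using close' ab' \<delta>2 by auto
  ultimately show False
    unfolding e_def dist_real_def by argo
qed

lemma second_derivative_symmetric:
  fixes f :: "'a::real_normed_vector \<Rightarrow> complex"
  assumes "open S" "x \<in> S" "times_differentiable_on 2 f S"
  shows "frechet_derivative (\<lambda>y. frechet_derivative f (at y) v) (at x) w
    = frechet_derivative (\<lambda>y. frechet_derivative f (at y) w) (at x) v"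
proof -
  have part: "L (frechet_derivative (\<lambda>y. frechet_derivative f (at y) v) (at x) w)
    = frechet_derivative (\<lambda>y. frechet_derivative (\<lambda>z. L (f z)) (at y) v) (at x) w"
    if L: "bounded_linear L" for L :: "complex \<Rightarrow> real" and v w
  proof -
    have diff: "f differentiable (at y)" "(\<lambda>y. frechet_derivative f (at y) v) differentiable (at y)"
      if "y \<in> S" for y
      using assms(3) that by (auto simp: numeral_2_eq_2)
    have "((\<lambda>y. L (frechet_derivative f (at y) v)) has_derivative
        (\<lambda>w. L (frechet_derivative (\<lambda>y. frechet_derivative f (at y) v) (at x) w))) (at x)"
      using bounded_linear.has_derivative[OF L] diff(2)[OF \<open>x \<in> S\<close>] frechet_derivative_works by blast
    then have "((\<lambda>y. frechet_derivative (\<lambda>z. L (f z)) (at y) v) has_derivative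
        (\<lambda>w. L (frechet_derivative (\<lambda>y. frechet_derivative f (at y) v) (at x) w))) (at x)"
      by (rule has_derivative_transform_within_open[OF _ \<open>open S\<close> \<open>x \<in> S\<close>])
        (simp add: frechet_derivative_bounded_linear_comp[OF L] diff)
    then show ?thesis
      using frechet_derivative_at by metis
  qed
  have "times_differentiable_on 2 (\<lambda>z. L (f z)) S" if "bounded_linear L" for L :: "complex \<Rightarrow> real"
    using times_differentiable_on_bounded_linear assms that by blast
  then have "L (frechet_derivative (\<lambda>y. frechet_derivative f (at y) v) (at x) w)
    = L (frechet_derivative (\<lambda>y. frechet_derivative f (at y) w) (at x) v)"
    if "bounded_linear L" for L :: "complex \<Rightarrow> real"
    unfolding part[OF that] using second_derivative_symmetric_real[OF assms(1,2)] that by blast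
  from this[OF bounded_linear_Re] this[OF bounded_linear_Im] show ?thesis
    by (rule complex_eqI)
qed

section \<open>Holomorphic functions of several variables\<close>

lemma norm_circlepath: "0 < r \<Longrightarrow> norm (circlepath 0 r t) = r"
  by (simp add: circlepath norm_mult)

lemma continuous_on_circlepath: "continuous_on T (circlepath 0 r)"
  unfolding circlepath by (intro continuous_intros)

text \<open>A Euclidean space with a complex scalar multiplication that extends the real one. It covers
  \<^typ>\<open>complex^'n\<close> and its square at once.\<close>

locale complex_structure = bounded_bilinear s
  for s :: "complex \<Rightarrow> 'a::euclidean_space \<Rightarrow> 'a" +
  assumes scale_scale: "s a (s b v) = s (a * b) v"
    and scale_of_real: "s (of_real r) v = r *\<^sub>R v"
begin

lemma scale_vector_space: "vector_space s"
  by unfold_locales (use scale_of_real[of 1] in \<open>auto simp: add_left add_right scale_scale\<close>)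

lemma holomorphic_map_on_iff:
  "holomorphic_map_on s (*) f S \<longleftrightarrow>
    (\<forall>x\<in>S. f differentiable (at x) \<and>
      (\<forall>c v. frechet_derivative f (at x) (s c v) = c * frechet_derivative f (at x) v))"
proof -
  have "vector_space ((*) :: complex \<Rightarrow> complex \<Rightarrow> complex)"
    by unfold_locales (auto simp: algebra_simps)
  then have "Vector_Spaces.linear s (*) f' \<longleftrightarrow> (\<forall>c v. f' (s c v) = c * f' v)"
    if "(f has_derivative f') (at x)" for f' x
    using that scale_vector_space linear_add[OF has_derivative_linear[OF that]]
    by (auto simp: Vector_Spaces.linear_iff)
  then show ?thesis
    unfolding holomorphic_map_on_def differentiable_def
    by (metis frechet_derivative_at)
qed

lemma holomorphic_map_on_cong:
  assumes "open S" "\<And>x. x \<in> S \<Longrightarrow> f x = g x" "holomorphic_map_on s (*) f S"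
  shows "holomorphic_map_on s (*) g S"
  using assms has_derivative_transform_within_open[of f _ _ UNIV S g]
  unfolding holomorphic_map_on_def by metis

lemma holomorphic_map_on_translate:
  assumes "holomorphic_map_on s (*) f S" "\<And>x. x \<in> T \<Longrightarrow> x + a \<in> S"
  shows "holomorphic_map_on s (*) (\<lambda>x. f (x + a) / c) T"
  unfolding holomorphic_map_on_iff
proof
  fix x assume "x \<in> T"
  then have f: "(f has_derivative frechet_derivative f (at (x + a))) (at (x + a))"
    "\<And>b v. frechet_derivative f (at (x + a)) (s b v) = b * frechet_derivative f (at (x + a)) v"
    using assms unfolding holomorphic_map_on_iff frechet_derivative_works by blast+
  have "((\<lambda>x. x + a) has_derivative (\<lambda>v. v)) (at x)"
    by (auto intro!: derivative_eq_intros)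
  from has_derivative_compose[OF this f(1)]
  have der: "((\<lambda>x. f (x + a) / c) has_derivative (\<lambda>v. frechet_derivative f (at (x + a)) v / c)) (at x)"
    unfolding divide_complex_def by (rule has_derivative_mult_left)
  show "(\<lambda>x. f (x + a) / c) differentiable (at x) \<and> (\<forall>b v.
      frechet_derivative (\<lambda>x. f (x + a) / c) (at x) (s b v)
      = b * frechet_derivative (\<lambda>x. f (x + a) / c) (at x) v)"
    unfolding frechet_derivative_eqI[OF der] f(2) using differentiableI[OF der] by simp
qed

lemma field_derivative_on_line:
  assumes "holomorphic_map_on s (*) f S" "x + s w v \<in> S"
  shows "((\<lambda>w. f (x + s w v)) has_field_derivative frechet_derivative f (at (x + s w v)) v) (at w)"
proof -
  have f: "(f has_derivative frechet_derivative f (at (x + s w v))) (at (x + s w v))"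
    "\<And>b. frechet_derivative f (at (x + s w v)) (s b v) = b * frechet_derivative f (at (x + s w v)) v"
    using assms unfolding holomorphic_map_on_iff frechet_derivative_works by blast+
  have "((\<lambda>w. x + s w v) has_derivative (\<lambda>b. s b v)) (at w)"
    using has_derivative_add[OF has_derivative_const
        bounded_linear_imp_has_derivative[OF bounded_linear_left]] by simp
  from has_derivative_compose[OF this f(1)] show ?thesis
    unfolding has_field_derivative_def f(2) by (simp add: mult_commute_abs)
qed

text \<open>Cauchy's formula for the first derivative, applied on the complex line through \<open>x\<close> in the
  direction \<open>v\<close>. It expresses a directional derivative through values of \<open>f\<close> only, and so turns
  continuity of \<open>f\<close> in parameters into continuity of its derivatives.\<close>

lemma cauchy_directional_derivative:
  assumes "holomorphic_map_on s (*) f S" "0 < r" "\<And>w. norm w \<le> r \<Longrightarrow> x + s w v \<in> S"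
  shows "frechet_derivative f (at x) v
    = integral {0..1} (\<lambda>t. f (x + s (circlepath 0 r t) v) / circlepath 0 r t)"
proof -
  define g where "g = (\<lambda>w. f (x + s w v))"
  have deriv: "(g has_field_derivative frechet_derivative f (at (x + s w v)) v) (at w)"
    if "norm w \<le> r" for w
    unfolding g_def using assms that by (intro field_derivative_on_line)
  have "continuous_on (cball 0 r) g"
    using deriv by (intro continuous_at_imp_continuous_on) (metis DERIV_isCont mem_cball_0)
  moreover have "g holomorphic_on ball 0 r"
    unfolding holomorphic_on_def field_differentiable_def
  proof
    fix w :: complex assume "w \<in> ball 0 r"
    then show "\<exists>g'. (g has_field_derivative g') (at w within ball 0 r)"
      using deriv[of w] has_field_derivative_at_within by fastforce
  qed
  ultimately have "(g has_field_derivative (1 / (2 * of_real pi * \<i>)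
      * contour_integral (circlepath 0 r) (\<lambda>u. g u / (u - 0)\<^sup>2))) (at 0)"
    using \<open>0 < r\<close> by (intro Cauchy_derivative_integral_circlepath) auto
  then have "frechet_derivative f (at (x + s 0 v)) v
      = 1 / (2 * of_real pi * \<i>) * contour_integral (circlepath 0 r) (\<lambda>u. g u / (u - 0)\<^sup>2)"
    using deriv[of 0] \<open>0 < r\<close> DERIV_unique by fastforce
  also have "\<dots> = integral {0..1} (\<lambda>t. 1 / (2 * of_real pi * \<i>)
      * (g (circlepath 0 r t) / (circlepath 0 r t)\<^sup>2 * (2 * pi * \<i> * circlepath 0 r t)))"
    unfolding contour_integral_integral vector_derivative_circlepath integral_mult_right
    by (simp add: circlepath mult.assoc del: integral_mult_right integral_divide)
  also have "\<dots> = integral {0..1} (\<lambda>t. g (circlepath 0 r t) / circlepath 0 r t)"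
    by (rule arg_cong2[where f = integral]) (auto simp: power2_eq_square)
  finally show ?thesis
    by (simp add: g_def zero_left)
qed

text \<open>A ball on which, for each direction \<open>v\<close>, Cauchy's formula can be used with one radius \<open>r\<close>.\<close>

lemma directional_radius:
  assumes "open S" "x0 \<in> S"
  obtains R where "0 < R" "ball x0 R \<subseteq> S"
    "\<And>v. \<exists>r>0. \<forall>x\<in>ball x0 R. \<forall>w. norm w \<le> r \<longrightarrow> x + s w v \<in> S"
proof -
  obtain R where R: "0 < R" "ball x0 R \<subseteq> S"
    using assms open_contains_ball by blast
  obtain K where K: "0 < K" "\<And>a b. norm (s a b) \<le> norm a * norm b * K"
    using pos_bounded by blast
  have "\<exists>r>0. \<forall>x\<in>ball x0 (R/2). \<forall>w. norm w \<le> r \<longrightarrow> x + s w v \<in> S" for v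
  proof (intro exI conjI ballI allI impI)
    define r where "r = R / (2 * (norm v * K + 1))"
    show "0 < R / (2 * (norm v * K + 1))"
      using R K by (simp add: add_nonneg_pos)
    fix x and w :: complex assume "x \<in> ball x0 (R/2)" and "norm w \<le> R / (2 * (norm v * K + 1))"
    moreover from this have "norm w * (norm v * K + 1) \<le> R / 2"
      using K add_nonneg_pos[of "norm v * K" 1]
      by (simp add: pos_le_divide_eq ac_simps)
    then have "norm w * norm v * K \<le> R / 2"
      by (simp add: algebra_simps) (smt (verit) norm_ge_zero)
    then have "norm (s w v) \<le> R / 2" using K order_trans by blast
    ultimately have "dist x0 (x + s w v) < R"
      using norm_triangle_ineq4[of "x0 - x" "s w v"] by (simp add: dist_norm algebra_simps)
    then show "x + s w v \<in> S" using R by auto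
  qed
  moreover have "ball x0 (R/2) \<subseteq> S" using R by force
  ultimately show ?thesis using that[of "R/2"] R by simp
qed

text \<open>Differentiation under the integral sign needs joint continuity of the derivative of \<open>G\<close> in \<open>x\<close>;
  Cauchy's formula derives it from the joint continuity of \<open>G\<close>.\<close>

lemma holomorphic_map_on_integral:
  assumes "open S" and cont: "continuous_on (S \<times> {0..1}) (\<lambda>(x, t). G x t)"
    and hol: "\<And>t. t \<in> {0..1} \<Longrightarrow> holomorphic_map_on s (*) (\<lambda>x. G x t) S"
  shows "holomorphic_map_on s (*) (\<lambda>x. integral {0..1::real} (G x)) S"
  unfolding holomorphic_map_on_iff
proof
  fix x0 assume "x0 \<in> S"
  obtain R where R: "0 < R" "ball x0 R \<subseteq> S"
    "\<And>v. \<exists>r>0. \<forall>x\<in>ball x0 R. \<forall>w. norm w \<le> r \<longrightarrow> x + s w v \<in> S"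
    using directional_radius[OF \<open>open S\<close> \<open>x0 \<in> S\<close>] by metis
  define B where "B = ball x0 R"
  have B: "open B" "convex B" "x0 \<in> B" "B \<subseteq> S" using R by (auto simp: B_def)
  define D where "D = (\<lambda>x t. Blinfun (frechet_derivative (\<lambda>x. G x t) (at x)))"
  have deriv: "((\<lambda>x. G x t) has_derivative frechet_derivative (\<lambda>x. G x t) (at x)) (at x)"
    if "x \<in> S" "t \<in> {0..1}" for x t
    using hol[OF that(2)] that unfolding holomorphic_map_on_iff frechet_derivative_works by blast
  have D: "blinfun_apply (D x t) = frechet_derivative (\<lambda>x. G x t) (at x)"
    if "x \<in> S" "t \<in> {0..1}" for x t
    unfolding D_def using has_derivative_bounded_linear[OF deriv[OF that]]
    by (rule bounded_linear_Blinfun_apply)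
  have contG: "continuous_on T (\<lambda>z. G (p z) (q z))"
    if "continuous_on T p" "continuous_on T q" "\<And>z. z \<in> T \<Longrightarrow> p z \<in> S \<and> q z \<in> {0..1}"
    for T :: "'z::topological_space set" and p q
    using continuous_on_compose2[OF cont continuous_on_Pair[OF that(1,2)]] that(3)
    by (simp add: image_subset_iff)
  have D_cont: "continuous_on (B \<times> cbox 0 1) (\<lambda>z. blinfun_apply (D (fst z) (snd z)) v)" for v
  proof -
    obtain r where r: "0 < r" "\<And>x w. x \<in> B \<Longrightarrow> norm w \<le> r \<Longrightarrow> x + s w v \<in> S"
      using R(3) B_def by metis
    have "continuous_on (B \<times> cbox 0 1) (\<lambda>z. integral (cbox 0 1)
        (\<lambda>t. G (fst z + s (circlepath 0 r t) v) (snd z) / circlepath 0 r t))"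
    proof (rule integral_continuous_on_param)
      have nz: "circlepath 0 r t \<noteq> 0" for t
        using norm_circlepath[OF r(1), of t] r(1) by auto
      show "continuous_on ((B \<times> cbox 0 1) \<times> cbox 0 1)
          (\<lambda>(z, t). G (fst z + s (circlepath 0 r t) v) (snd z) / circlepath 0 r t)"
        unfolding split_beta
      proof (intro continuous_on_divide contG)
        show "continuous_on ((B \<times> cbox 0 1) \<times> cbox 0 1)
            (\<lambda>z. fst (fst z) + s (circlepath 0 r (snd z)) v)"
          by (intro continuous_intros continuous_on continuous_on_compose2[OF
              continuous_on_circlepath[of UNIV r]]) auto
        show "continuous_on ((B \<times> cbox 0 1) \<times> cbox 0 1) (\<lambda>z. circlepath 0 r (snd z))"
          by (intro continuous_on_compose2[OF continuous_on_circlepath[of UNIV r]]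
              continuous_intros) auto
      qed (use r norm_circlepath nz in \<open>auto intro!: continuous_intros\<close>)
    qed
    then show ?thesis
    proof (rule continuous_on_eq)
      fix z assume z: "z \<in> B \<times> cbox 0 (1::real)"
      then show "integral (cbox 0 1)
          (\<lambda>t. G (fst z + s (circlepath 0 r t) v) (snd z) / circlepath 0 r t)
        = blinfun_apply (D (fst z) (snd z)) v"
        using cauchy_directional_derivative[OF hol r(1), of "snd z" "fst z" v] r(2) B D
        by auto
    qed
  qed
  have D_cont': "continuous_on (B \<times> cbox 0 1) (\<lambda>(x, t). D x t)"
    unfolding split_beta by (rule continuous_on_blinfun_componentwise) (rule D_cont)
  have int: "D x0 integrable_on cbox 0 1"
    using continuous_on_compose2[OF D_cont'
        continuous_on_Pair[OF continuous_on_const[of _ x0] continuous_on_id]] \<open>x0 \<in> B\<close>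
    by (intro integrable_continuous) auto
  have "((\<lambda>x. integral (cbox 0 1) (G x)) has_derivative integral (cbox 0 1) (D x0)) (at x0 within B)"
  proof (rule leibniz_rule[OF _ _ D_cont'])
    show "((\<lambda>x. G x t) has_derivative blinfun_apply (D x t)) (at x within B)"
      if "x \<in> B" "t \<in> cbox 0 1" for x t
      using deriv[of x t] D[of x t] that B(4) has_derivative_at_withinI by (metis cbox_interval subsetD)
    show "G x integrable_on cbox 0 1" if "x \<in> B" for x
      using that B by (intro integrable_continuous contG) (auto intro!: continuous_intros)
  qed (use B in auto)
  then have der: "((\<lambda>x. integral {0..1} (G x)) has_derivative integral (cbox 0 1) (D x0)) (at x0)"
    by (simp only: at_within_open[OF B(3,1)] cbox_interval)
  have int_apply: "blinfun_apply (integral (cbox 0 1) (D x0)) v = integral (cbox 0 1) (\<lambda>t. D x0 t v)" for v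
    using integral_linear[OF int blinfun.bounded_linear_left, of v] by (simp add: o_def)
  have lin: "blinfun_apply (D x0 t) (s c v) = c * blinfun_apply (D x0 t) v"
    if "t \<in> cbox 0 1" for t c v
    using hol[of t] that \<open>x0 \<in> S\<close> D[of x0 t] unfolding holomorphic_map_on_iff by simp
  have "blinfun_apply (integral (cbox 0 1) (D x0)) (s c v)
      = c * blinfun_apply (integral (cbox 0 1) (D x0)) v" for c v
    unfolding int_apply using lin by (subst integral_mult_right[symmetric]) (rule integral_cong, simp)
  then show "(\<lambda>x. integral {0..1} (G x)) differentiable (at x0) \<and> (\<forall>c v.
      frechet_derivative (\<lambda>x. integral {0..1} (G x)) (at x0) (s c v)
      = c * frechet_derivative (\<lambda>x. integral {0..1} (G x)) (at x0) v)"
    using frechet_derivative_eqI[OF der] differentiableI[OF der] by simp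
qed

lemma holomorphic_map_on_imp_continuous_on:
  "holomorphic_map_on s (*) f S \<Longrightarrow> continuous_on S f"
  unfolding holomorphic_map_on_iff
  by (meson continuous_at_imp_continuous_on differentiable_imp_continuous_within)

text \<open>Cauchy's formula writes the derivative as an integral of translates of \<open>f\<close>, to which the previous
  result on parameter integrals applies.\<close>

lemma holomorphic_map_on_directional_derivative:
  assumes "open S" "holomorphic_map_on s (*) f S"
  shows "holomorphic_map_on s (*) (\<lambda>x. frechet_derivative f (at x) v) S"
proof -
  have "\<exists>B. x0 \<in> B \<and> holomorphic_map_on s (*) (\<lambda>x. frechet_derivative f (at x) v) B" if "x0 \<in> S" for x0
  proof -
    obtain R where R: "0 < R" "ball x0 R \<subseteq> S"
      "\<And>v. \<exists>r>0. \<forall>x\<in>ball x0 R. \<forall>w. norm w \<le> r \<longrightarrow> x + s w v \<in> S"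
      using directional_radius[OF \<open>open S\<close> \<open>x0 \<in> S\<close>] by metis
    obtain r where r: "0 < r" "\<And>x w. x \<in> ball x0 R \<Longrightarrow> norm w \<le> r \<Longrightarrow> x + s w v \<in> S"
      using R(3) by metis
    define G where "G = (\<lambda>x t. f (x + s (circlepath 0 r t) v) / circlepath 0 r t)"
    have nz: "circlepath 0 r t \<noteq> 0" for t
      using norm_circlepath[OF r(1), of t] r(1) by auto
    have "holomorphic_map_on s (*) (\<lambda>x. integral {0..1} (G x)) (ball x0 R)"
    proof (rule holomorphic_map_on_integral)
      show "continuous_on (ball x0 R \<times> {0..1}) (\<lambda>(x, t). G x t)"
        unfolding split_beta G_def
      proof (intro continuous_on_divide
          continuous_on_compose2[OF holomorphic_map_on_imp_continuous_on[OF assms(2)]])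
        show "continuous_on (ball x0 R \<times> {0..1}) (\<lambda>z. fst z + s (circlepath 0 r (snd z)) v)"
          by (intro continuous_intros continuous_on continuous_on_compose2[OF
              continuous_on_circlepath[of UNIV r]]) auto
        show "continuous_on (ball x0 R \<times> {0..1}) (\<lambda>z. circlepath 0 r (snd z))"
          by (intro continuous_on_compose2[OF continuous_on_circlepath[of UNIV r]]
              continuous_intros) auto
      qed (use r norm_circlepath nz in auto)
      show "holomorphic_map_on s (*) (\<lambda>x. G x t) (ball x0 R)" for t
        unfolding G_def using r norm_circlepath
        by (intro holomorphic_map_on_translate[OF assms(2)]) auto
    qed simp
    moreover have "integral {0..1} (G x) = frechet_derivative f (at x) v" if "x \<in> ball x0 R" for x
      unfolding G_def using cauchy_directional_derivative[OF assms(2) r(1)] r(2) that by simp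
    ultimately have "holomorphic_map_on s (*) (\<lambda>x. frechet_derivative f (at x) v) (ball x0 R)"
      by (rule holomorphic_map_on_cong[OF open_ball, rotated -1])
    then show ?thesis using R(1) by (intro exI[of _ "ball x0 R"]) simp
  qed
  then show ?thesis unfolding holomorphic_map_on_def by metis
qed

lemma holomorphic_map_on_imp_times_differentiable_on:
  assumes "open S" "holomorphic_map_on s (*) f S"
  shows "times_differentiable_on n f S"
  using assms(2)
proof (induction n arbitrary: f)
  case 0
  then show ?case by (simp add: holomorphic_map_on_imp_continuous_on)
next
  case (Suc n)
  then show ?case
    using holomorphic_map_on_directional_derivative[OF \<open>open S\<close>]
    by (simp add: holomorphic_map_on_iff)
qed

end

lemma bounded_bilinear_vector_scalar_mult:
  "bounded_bilinear ((*s) :: complex \<Rightarrow> complex^'n \<Rightarrow> complex^'n)"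
proof
  show "\<exists>K. \<forall>a (b :: complex^'n). norm (a *s b) \<le> norm a * norm b * K"
    by (intro exI[of _ 1]) (simp add: norm_vec_def L2_set_right_distrib norm_mult)
qed (auto simp: vec_eq_iff algebra_simps)

interpretation vec_structure: complex_structure "(*s) :: complex \<Rightarrow> complex^'n \<Rightarrow> complex^'n"
proof -
  interpret bounded_bilinear "(*s) :: complex \<Rightarrow> complex^'n \<Rightarrow> complex^'n"
    by (rule bounded_bilinear_vector_scalar_mult)
  show "complex_structure ((*s) :: complex \<Rightarrow> complex^'n \<Rightarrow> complex^'n)"
    by unfold_locales (auto simp: vec_eq_iff scaleR_conv_of_real[where 'a = complex])
qed

interpretation pair_structure: complex_structure
  "pair_scale :: complex \<Rightarrow> (complex^'n) \<times> (complex^'n) \<Rightarrow> (complex^'n) \<times> (complex^'n)"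
proof -
  have "norm (pair_scale a b) \<le> norm a * norm b" for a and b :: "(complex^'n) \<times> (complex^'n)"
    by (cases b) (simp add: pair_scale_def norm_Pair norm_vec_def L2_set_right_distrib[symmetric]
        norm_mult power_mult_distrib real_sqrt_mult flip: distrib_left)
  then have "\<exists>K. \<forall>a (b :: (complex^'n) \<times> (complex^'n)). norm (pair_scale a b) \<le> norm a * norm b * K"
    by (intro exI[of _ 1]) simp
  then interpret P: bounded_bilinear
    "pair_scale :: complex \<Rightarrow> (complex^'n) \<times> (complex^'n) \<Rightarrow> (complex^'n) \<times> (complex^'n)"
    by (rule bounded_bilinear.intro[rotated -1]) (simp_all add: pair_scale_def vec_structure.add_left
        vec_structure.add_right vec_structure.scaleR_left vec_structure.scaleR_right)
  show "complex_structure (pair_scale :: complex \<Rightarrow> (complex^'n) \<times> (complex^'n) \<Rightarrow> _)"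
    by unfold_locales (auto simp: pair_scale_def vec_eq_iff prod_eq_iff
        scaleR_conv_of_real[where 'a = complex])
qed

section \<open>Vectors dual to linear forms\<close>

lemma wedge_alternating:
  assumes "j < d" "l < d" "j \<noteq> l" "\<beta> j = \<beta> l"
  shows "wedge d \<beta> v = 0"
proof -
  define t where "t = Transposition.transpose j l"
  have t: "t permutes {..<d}" unfolding t_def using assms by (intro permutes_swap_id) auto
  have \<beta>: "\<beta> (t k) = \<beta> k" for k
    using assms(4) by (simp add: t_def Transposition.transpose_def)
  have sgn: "sign (t \<circ> \<pi>) = - sign \<pi>" if "\<pi> permutes {..<d}" for \<pi>
    using sign_compose[OF permutes_imp_permutation[OF _ t] permutes_imp_permutation[OF _ that]]
      assms(3) by (simp add: t_def sign_swap_id)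
  have "wedge d \<beta> v = (\<Sum>\<pi> | \<pi> permutes {..<d}.
      of_int (sign (t \<circ> \<pi>)) * (\<Prod>i<d. \<beta> ((t \<circ> \<pi>) i) (v i)))"
    unfolding wedge_def by (rule setum_permutations_compose_left[OF t])
  also have "\<dots> = (\<Sum>\<pi> | \<pi> permutes {..<d}. - (of_int (sign \<pi>) * (\<Prod>i<d. \<beta> (\<pi> i) (v i))))"
    by (rule sum.cong) (simp_all add: sgn \<beta>)
  also have "\<dots> = - wedge d \<beta> v" by (simp add: wedge_def sum_negf)
  finally show ?thesis by simp
qed

text \<open>Contracting the wedge product against all the vectors but one gives, up to a factor, the vectors
  dual to the forms: \<open>\<alpha> l\<close> of the \<open>j\<close>-th of them is the wedge product with \<open>\<alpha> j\<close> replaced by \<open>\<alpha> l\<close>.\<close>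

lemma wedge_nonzero_dual_vectors:
  fixes \<alpha> :: "nat \<Rightarrow> complex^'n \<Rightarrow> complex"
  assumes lin: "\<And>j. j < d \<Longrightarrow> linear (\<alpha> j)" "\<And>j c x. j < d \<Longrightarrow> \<alpha> j (c *s x) = c * \<alpha> j x"
    and nz: "wedge d \<alpha> \<noteq> (\<lambda>v. 0)"
  obtains e where "\<And>i j. i < d \<Longrightarrow> j < d \<Longrightarrow> \<alpha> i (e j) = (if i = j then 1 else 0)"
proof -
  obtain v where v: "wedge d \<alpha> v \<noteq> 0" using nz by auto
  define E where "E = (\<lambda>j. \<Sum>\<pi> | \<pi> permutes {..<d}.
      (of_int (sign \<pi>) * (\<Prod>i\<in>{..<d} - {inv \<pi> j}. \<alpha> (\<pi> i) (v i))) *s v (inv \<pi> j))"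
  have E: "\<alpha> l (E j) = wedge d (\<alpha>(j := \<alpha> l)) v" if "l < d" "j < d" for l j
  proof -
    have "\<alpha> l (E j) = (\<Sum>\<pi> | \<pi> permutes {..<d}. of_int (sign \<pi>)
        * (\<Prod>i\<in>{..<d} - {inv \<pi> j}. \<alpha> (\<pi> i) (v i)) * \<alpha> l (v (inv \<pi> j)))"
      unfolding E_def linear_sum[OF lin(1)[OF that(1)]] using lin(2)[OF that(1)] by simp
    also have "\<dots> = wedge d (\<alpha>(j := \<alpha> l)) v"
      unfolding wedge_def
    proof (rule sum.cong)
      fix \<pi> assume "\<pi> \<in> {\<pi>. \<pi> permutes {..<d}}"
      then have \<pi>: "\<pi> permutes {..<d}" by simp
      have "inv \<pi> j \<in> {..<d}"
        using permutes_in_image[OF permutes_inv[OF \<pi>]] that(2) by auto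
      then have "(\<Prod>i<d. (\<alpha>(j := \<alpha> l)) (\<pi> i) (v i)) = (\<alpha>(j := \<alpha> l)) (\<pi> (inv \<pi> j)) (v (inv \<pi> j))
          * (\<Prod>i\<in>{..<d} - {inv \<pi> j}. (\<alpha>(j := \<alpha> l)) (\<pi> i) (v i))"
        by (intro prod.remove) auto
      also have "(\<Prod>i\<in>{..<d} - {inv \<pi> j}. (\<alpha>(j := \<alpha> l)) (\<pi> i) (v i))
          = (\<Prod>i\<in>{..<d} - {inv \<pi> j}. \<alpha> (\<pi> i) (v i))"
        using permutes_inverses[OF \<pi>] by (intro prod.cong) auto
      finally show "of_int (sign \<pi>) * (\<Prod>i\<in>{..<d} - {inv \<pi> j}. \<alpha> (\<pi> i) (v i)) * \<alpha> l (v (inv \<pi> j))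
          = of_int (sign \<pi>) * (\<Prod>i<d. (\<alpha>(j := \<alpha> l)) (\<pi> i) (v i))"
        using permutes_inverses[OF \<pi>] by simp
    qed simp
    finally show ?thesis .
  qed
  have "\<alpha> l (inverse (wedge d \<alpha> v) *s E j) = (if l = j then 1 else 0)" if "l < d" "j < d" for l j
    using E[OF that] that lin(2)[OF that(1)] v wedge_alternating[of j d l "\<alpha>(j := \<alpha> l)" v]
    by auto
  then show ?thesis by (rule that)
qed

section \<open>Generic submanifolds\<close>

lemma cnj_vec_cnj_vec [simp]: "cnj_vec (cnj_vec Z) = Z"
  by (simp add: cnj_vec_def vec_eq_iff)

lemma cnj_vec_zero [simp]: "cnj_vec 0 = 0"
  by (simp add: cnj_vec_def vec_eq_iff)

lemma cnj_vec_nth [simp]: "cnj_vec Z $ k = cnj (Z $ k)"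
  by (simp add: cnj_vec_def)

lemma cnj_vec_scale: "cnj_vec (c *s Z) = cnj c *s cnj_vec Z"
  by (simp add: vec_eq_iff)

lemma linear_cnj_vec: "linear (cnj_vec :: complex^'n \<Rightarrow> complex^'n)"
  by (rule linearI) (simp_all add: vec_eq_iff)

lemma bounded_linear_cnj_vec: "bounded_linear (cnj_vec :: complex^'n \<Rightarrow> complex^'n)"
  using linear_cnj_vec linear_conv_bounded_linear by blast

lemma cnj_vec_image: "cnj_vec ` U = cnj_vec -` U"
  by (force simp: image_iff intro: cnj_vec_cnj_vec[symmetric])

lemma open_cnj_vec_image: "open U \<Longrightarrow> open (cnj_vec ` U)"
  unfolding cnj_vec_image
  by (rule open_vimage[OF _ linear_continuous_on[OF bounded_linear_cnj_vec]])

locale generic_manifold =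
  fixes M :: "(complex^'n) set" and d and \<rho> and U
  assumes generic: "generic_submanifold M d \<rho> U"
begin

lemma open_domain: "open U" "open (U \<times> cnj_vec ` U)"
  using generic by (auto simp: generic_submanifold_def intro: open_Times open_cnj_vec_image)

lemma in_domain: "Z \<in> U \<Longrightarrow> (Z, cnj_vec Z) \<in> U \<times> cnj_vec ` U"
  by auto

lemma mem_iff: "Z \<in> U \<Longrightarrow> Z \<in> M \<longleftrightarrow> (\<forall>j<d. \<rho> j (Z, cnj_vec Z) = 0)"
  using generic unfolding generic_submanifold_def by blast

lemma holomorphic: "j < d \<Longrightarrow> holomorphic_map_on pair_scale (*) (\<rho> j) (U \<times> cnj_vec ` U)"
  using generic unfolding generic_submanifold_def by blast

lemma has_derivative:
  "j < d \<Longrightarrow> q \<in> U \<times> cnj_vec ` U \<Longrightarrow> (\<rho> j has_derivative frechet_derivative (\<rho> j) (at q)) (at q)"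
  using holomorphic[of j] unfolding pair_structure.holomorphic_map_on_iff frechet_derivative_works
  by blast

lemma derivative_scale:
  "j < d \<Longrightarrow> q \<in> U \<times> cnj_vec ` U \<Longrightarrow>
    frechet_derivative (\<rho> j) (at q) (c *s a, c *s b) = c * frechet_derivative (\<rho> j) (at q) (a, b)"
  using holomorphic[of j] unfolding pair_structure.holomorphic_map_on_iff
  by (metis fst_conv snd_conv pair_scale_def)

lemma derivative_split:
  assumes "j < d" "q \<in> U \<times> cnj_vec ` U"
  shows "frechet_derivative (\<rho> j) (at q) (a, b)
    = dZ (\<rho> j) q a + frechet_derivative (\<rho> j) (at q) (0, b)"
  using linear_add[OF has_derivative_linear[OF has_derivative[OF assms]], of "(a, 0)" "(0, b)"]
  by (simp add: dZ_def)

lemma linear_dZ: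
  assumes "j < d" "q \<in> U \<times> cnj_vec ` U"
  shows "linear (dZ (\<rho> j) q)" "dZ (\<rho> j) q (c *s a) = c * dZ (\<rho> j) q a"
proof -
  have "linear (\<lambda>a :: complex^'n. (a, 0 :: complex^'n))"
    by (rule linearI) auto
  from linear_compose[OF this has_derivative_linear[OF has_derivative[OF assms]]]
  show "linear (dZ (\<rho> j) q)" by (simp add: dZ_def[abs_def] o_def)
  show "dZ (\<rho> j) q (c *s a) = c * dZ (\<rho> j) q a"
    using derivative_scale[OF assms, of c a 0] by (simp add: dZ_def)
qed

lemma dual_vectors:
  assumes "q \<in> U \<times> cnj_vec ` U"
  obtains e where "\<And>i j. i < d \<Longrightarrow> j < d \<Longrightarrow> dZ (\<rho> i) q (e j) = (if i = j then 1 else 0)"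
proof (rule wedge_nonzero_dual_vectors[of d "\<lambda>j. dZ (\<rho> j) q"])
  show "wedge d (\<lambda>j. dZ (\<rho> j) q) \<noteq> (\<lambda>v. 0)"
    using generic assms unfolding generic_submanifold_def by blast
qed (blast intro: linear_dZ[OF _ assms] that)+

lemma reality:
  "j < d \<Longrightarrow> (Z, \<zeta>) \<in> U \<times> cnj_vec ` U \<Longrightarrow> \<rho> j (Z, \<zeta>) = cnj (\<rho> j (cnj_vec \<zeta>, cnj_vec Z))"
  using generic unfolding generic_submanifold_def by blast

lemma real_on_diagonal: "j < d \<Longrightarrow> Z \<in> U \<Longrightarrow> cnj (\<rho> j (Z, cnj_vec Z)) = \<rho> j (Z, cnj_vec Z)"
  using reality[of j Z "cnj_vec Z"] by simp

text \<open>The reality condition says that \<open>\<rho> j\<close> is conjugated by the involution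
  \<open>(Z, \<zeta>) \<mapsto> (cnj_vec \<zeta>, cnj_vec Z)\<close>, whose fixed points are the points \<open>(Z, cnj_vec Z)\<close>.\<close>

lemma derivative_cnj:
  assumes "j < d" "Z \<in> U"
  shows "frechet_derivative (\<rho> j) (at (Z, cnj_vec Z)) (a, b)
    = cnj (frechet_derivative (\<rho> j) (at (Z, cnj_vec Z)) (cnj_vec b, cnj_vec a))"
proof -
  define \<sigma> where "\<sigma> = (\<lambda>p :: (complex^'n) \<times> (complex^'n). (cnj_vec (snd p), cnj_vec (fst p)))"
  define q where "q = (Z, cnj_vec Z)"
  have \<sigma>: "bounded_linear \<sigma>"
    unfolding \<sigma>_def
    by (intro bounded_linear_Pair bounded_linear_compose[OF bounded_linear_cnj_vec]
        bounded_linear_fst bounded_linear_snd)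
  have "\<sigma> q = q" by (simp add: \<sigma>_def q_def)
  have q: "q \<in> U \<times> cnj_vec ` U" using assms by (simp add: q_def)
  have "((\<lambda>p. \<rho> j (\<sigma> p)) has_derivative (\<lambda>w. frechet_derivative (\<rho> j) (at q) (\<sigma> w))) (at q)"
    using has_derivative_compose[OF bounded_linear_imp_has_derivative[OF \<sigma>], of "\<rho> j" _ q]
      has_derivative[OF assms(1) q] \<open>\<sigma> q = q\<close> by metis
  from has_derivative_cnj[OF this]
  have "(\<rho> j has_derivative (\<lambda>w. cnj (frechet_derivative (\<rho> j) (at q) (\<sigma> w)))) (at q)"
  proof (rule has_derivative_transform_within_open[OF _ open_domain(2) q])
    fix p assume "p \<in> U \<times> cnj_vec ` U"
    then show "cnj (\<rho> j (\<sigma> p)) = \<rho> j p"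
      using reality[OF assms(1), of "fst p" "snd p"] unfolding \<sigma>_def by simp
  qed
  from fun_cong[OF frechet_derivative_eqI[OF this], of "(a, b)"] show ?thesis
    unfolding q_def \<sigma>_def fst_conv snd_conv .
qed

end

section \<open>Tangential derivatives of functions vanishing on the manifold\<close>

text \<open>The map \<open>F\<close> is tangent to the identity at \<open>z\<close>, and all points that it sends to \<open>z + T\<close> are zeros
  of \<open>u\<close>. By the open mapping theorem for maps that are differentiable at
  one point, the points \<open>z + r v\<close> with small \<open>r\<close> are images of such zeros, which
  differ from them by an error of smaller order than \<open>r\<close>.\<close>

lemma derivative_zero_if_straightened:
  fixes F :: "'a::euclidean_space \<Rightarrow> 'a" and u :: "'a \<Rightarrow> 'b::real_normed_vector"
  assumes "open N" "z \<in> N" and F: "continuous_on N F" "F z = z" "(F has_derivative (\<lambda>x. x)) (at z)"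
    and u: "u z = 0" "(u has_derivative u') (at z)"
    and zero: "\<And>W. W \<in> N \<Longrightarrow> F W - z \<in> T \<Longrightarrow> u W = 0"
    and T: "\<And>r. r *\<^sub>R v \<in> T"
  shows "u' v = 0"
proof -
  interpret u': bounded_linear u' using u(2) by (rule has_derivative_bounded_linear)
  obtain K where K: "0 < K" "\<And>x. norm (u' x) \<le> norm x * K"
    using u'.pos_bounded by blast
  have bound: "norm (u' v) \<le> \<epsilon> * (2 * (1 + K) * norm v)" if \<epsilon>: "0 < \<epsilon>" "\<epsilon> < 1/2" for \<epsilon>
  proof -
    obtain \<delta>1 where \<delta>1: "\<delta>1 > 0"
      "\<And>W. norm (W - z) < \<delta>1 \<Longrightarrow> norm (F W - F z - (W - z)) \<le> \<epsilon> * norm (W - z)"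
      using F(3) \<epsilon>(1) unfolding has_derivative_at_alt by blast
    obtain \<delta>2 where \<delta>2: "\<delta>2 > 0"
      "\<And>W. norm (W - z) < \<delta>2 \<Longrightarrow> norm (u W - u z - u' (W - z)) \<le> \<epsilon> * norm (W - z)"
      using u(2) \<epsilon>(1) unfolding has_derivative_at_alt by blast
    obtain \<delta>3 where \<delta>3: "\<delta>3 > 0" "ball z \<delta>3 \<subseteq> N"
      using assms(1,2) open_contains_ball by blast
    define B where "B = ball z (min \<delta>1 (min \<delta>2 \<delta>3))"
    have "F z \<in> interior (F ` B)"
    proof (rule sussmann_open_mapping[OF assms(1) F(1) assms(2) F(3), of "\<lambda>x. x"])
      show "z \<in> interior B" using \<delta>1 \<delta>2 \<delta>3 by (simp add: B_def)
    qed (use \<delta>3 in \<open>auto simp: B_def\<close>)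
    then obtain \<eta> where \<eta>: "\<eta> > 0" "ball z \<eta> \<subseteq> F ` B"
      using F(2) by (auto simp: mem_interior)
    define r where "r = \<eta> / (norm v + 1)"
    have r: "r > 0" using \<eta> by (simp add: r_def add_nonneg_pos)
    have "r * norm v < r * (norm v + 1)" using r by simp
    then have "r * norm v < \<eta>"
      using norm_ge_zero[of v] by (simp add: r_def add_nonneg_eq_0_iff)
    then have "z + r *\<^sub>R v \<in> ball z \<eta>" using r by (simp add: dist_norm)
    then obtain W where W: "W \<in> B" "F W = z + r *\<^sub>R v" using \<eta>(2) by force
    have near: "norm (W - z) < \<delta>1" "norm (W - z) < \<delta>2" "W \<in> N"
      using W(1) \<delta>3 by (auto simp: B_def dist_norm norm_minus_commute)
    have "u W = 0" using zero[of W] near T[of r] W(2) by simp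
    have close: "norm (r *\<^sub>R v - (W - z)) \<le> \<epsilon> * norm (W - z)"
      using \<delta>1(2)[OF near(1)] F(2) W(2) by simp
    have "norm (W - z) \<le> norm (r *\<^sub>R v) + norm (r *\<^sub>R v - (W - z))"
      using norm_triangle_sub[of "W - z" "r *\<^sub>R v"] by (simp add: norm_minus_commute)
    also have "\<dots> \<le> r * norm v + 1/2 * norm (W - z)"
      using close mult_right_mono[of \<epsilon> "1/2" "norm (W - z)"] \<epsilon> r by simp
    finally have Wz: "norm (W - z) \<le> 2 * r * norm v" by simp
    have "r * norm (u' v) = norm (u' (r *\<^sub>R v))" using r by (simp add: u'.scaleR)
    also have "\<dots> \<le> norm (u' (W - z)) + norm (u' (r *\<^sub>R v - (W - z)))"
      using norm_triangle_ineq[of "u' (W - z)" "u' (r *\<^sub>R v - (W - z))"] by (simp add: u'.diff)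
    also have "\<dots> \<le> \<epsilon> * norm (W - z) + \<epsilon> * norm (W - z) * K"
      using \<delta>2(2)[OF near(2)] u(1) \<open>u W = 0\<close> K(2)[of "r *\<^sub>R v - (W - z)"] close K(1)
      by (intro add_mono) (auto intro: order_trans mult_right_mono)
    also have "\<dots> = \<epsilon> * (1 + K) * norm (W - z)" by (simp add: algebra_simps)
    also have "\<dots> \<le> \<epsilon> * (1 + K) * (2 * r * norm v)"
      using Wz \<epsilon> K by (intro mult_left_mono) auto
    finally have "r * norm (u' v) \<le> r * (\<epsilon> * (2 * (1 + K) * norm v))" by (simp add: algebra_simps)
    then show ?thesis using r by simp
  qed
  have "((\<lambda>\<epsilon>. \<epsilon> * (2 * (1 + K) * norm v)) \<longlongrightarrow> 0 * (2 * (1 + K) * norm v)) (at_right 0)"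
    by (intro tendsto_intros)
  moreover have "\<forall>\<^sub>F \<epsilon> in at_right 0. norm (u' v) \<le> \<epsilon> * (2 * (1 + K) * norm v)"
    using bound by (auto simp: eventually_at_right_field intro!: exI[of _ "1/2"])
  ultimately have "norm (u' v) \<le> 0 * (2 * (1 + K) * norm v)"
    by (intro tendsto_lowerbound) auto
  then show ?thesis by simp
qed

context generic_manifold
begin

text \<open>With \<open>e\<close> dual to the forms \<open>\<partial>\<^sub>Z \<rho> j\<close> at \<open>Z\<close>, moving along \<open>e j\<close> by half of \<open>\<rho> j\<close> minus its
  linear part straightens \<open>M\<close> to its real tangent space at \<open>Z\<close>; the half is there because the
  differential of the real function \<open>\<rho> j\<close> on \<open>C^n\<close> is twice the real part of \<open>\<partial>\<^sub>Z \<rho> j\<close>.\<close>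

lemma real_tangent_derivative_zero:
  assumes "Z \<in> M" "Z \<in> U" "open V" "Z \<in> V" and zero: "\<And>W. W \<in> M \<inter> V \<Longrightarrow> u W = 0"
    and u: "(u has_derivative u') (at Z)"
    and v: "\<And>j. j < d \<Longrightarrow> Re (dZ (\<rho> j) (Z, cnj_vec Z) v) = 0"
  shows "u' v = 0"
proof -
  define q where "q = (Z, cnj_vec Z)"
  have q: "q \<in> U \<times> cnj_vec ` U" using assms by (simp add: q_def)
  define \<alpha> where "\<alpha> = (\<lambda>j. dZ (\<rho> j) q)"
  obtain e where e: "\<And>i j. i < d \<Longrightarrow> j < d \<Longrightarrow> \<alpha> i (e j) = (if i = j then 1 else 0)"
    using dual_vectors[OF q] unfolding \<alpha>_def by blast
  have lin: "linear (\<alpha> j)" if "j < d" for j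
    using linear_dZ(1)[OF that q] by (simp add: \<alpha>_def)
  define r where "r = (\<lambda>j W. Re (\<rho> j (W, cnj_vec W)))"
  define F where "F = (\<lambda>W. W + (\<Sum>j<d. (r j W / 2 - Re (\<alpha> j (W - Z))) *\<^sub>R e j))"
  have r_deriv: "(r j has_derivative (\<lambda>w. Re (frechet_derivative (\<rho> j) (at (W, cnj_vec W)) (w, cnj_vec w)))) (at W)"
    if "j < d" "W \<in> U" for j W
  proof -
    have "((\<lambda>W. (W, cnj_vec W)) has_derivative (\<lambda>w. (w, cnj_vec w))) (at W)"
      by (intro has_derivative_Pair has_derivative_ident
          bounded_linear_imp_has_derivative[OF bounded_linear_cnj_vec])
    from has_derivative_compose[OF this has_derivative[OF \<open>j < d\<close> in_domain[OF \<open>W \<in> U\<close>]]]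
    show ?thesis unfolding r_def by (rule has_derivative_Re)
  qed
  have "2 * Re (\<alpha> j w) = Re (frechet_derivative (\<rho> j) (at q) (w, cnj_vec w))" if "j < d" for j w
    using derivative_split[OF that q, of w "cnj_vec w"] derivative_cnj[OF that \<open>Z \<in> U\<close>, of 0 "cnj_vec w"]
    by (simp add: \<alpha>_def q_def dZ_def)
  then have r_deriv_Z: "(r j has_derivative (\<lambda>w. 2 * Re (\<alpha> j w))) (at Z)" if "j < d" for j
    using r_deriv[OF that \<open>Z \<in> U\<close>] that by (simp add: q_def)
  have \<alpha>_deriv: "((\<lambda>W. Re (\<alpha> j (W - Z))) has_derivative (\<lambda>w. Re (\<alpha> j w))) (at W)" if "j < d" for j W
  proof -
    have "((\<lambda>W. W - Z) has_derivative (\<lambda>w. w)) (at W)"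
      by (auto intro!: derivative_eq_intros)
    from has_derivative_compose[OF this linear_imp_has_derivative[OF lin[OF that]]]
    show ?thesis by (rule has_derivative_Re)
  qed
  have "(F has_derivative (\<lambda>w. w + (\<Sum>j<d. (2 * Re (\<alpha> j w) / 2 - Re (\<alpha> j w)) *\<^sub>R e j))) (at Z)"
    unfolding F_def
    by (intro has_derivative_add has_derivative_ident has_derivative_sum has_derivative_scaleR_left
        has_derivative_diff \<alpha>_deriv bounded_linear.has_derivative[OF bounded_linear_divide] r_deriv_Z) auto
  then have F': "(F has_derivative (\<lambda>w. w)) (at Z)" by simp
  have "continuous_on U F"
    unfolding F_def
  proof (intro continuous_on_add continuous_on_id continuous_on_sum continuous_on_scaleR
      continuous_on_diff continuous_on_divide continuous_on_const)
    show "continuous_on U (r j)" if "j \<in> {..<d}" for j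
      using r_deriv that has_derivative_continuous by (intro continuous_at_imp_continuous_on) blast
    show "continuous_on U (\<lambda>W. Re (\<alpha> j (W - Z)))" if "j \<in> {..<d}" for j
      using \<alpha>_deriv that has_derivative_continuous by (intro continuous_at_imp_continuous_on) blast
  qed auto
  have "F Z = Z"
    unfolding F_def using assms(1) mem_iff[OF \<open>Z \<in> U\<close>] linear_0[OF lin] by (simp add: r_def)
  have F_\<alpha>: "Re (\<alpha> i (F W - Z)) = r i W / 2" if "i < d" for i W
  proof -
    have "\<alpha> i (F W - Z) = \<alpha> i (W - Z) + (\<Sum>j<d. (r j W / 2 - Re (\<alpha> j (W - Z))) *\<^sub>R \<alpha> i (e j))"
      unfolding F_def add_diff_eq[symmetric] add.commute[of W]
      unfolding add.commute[of _ "W - Z"] linear_add[OF lin[OF that]] linear_sum[OF lin[OF that]]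
        linear_scale[OF lin[OF that]] ..
    also have "(\<Sum>j<d. (r j W / 2 - Re (\<alpha> j (W - Z))) *\<^sub>R \<alpha> i (e j))
        = (\<Sum>j<d. if i = j then complex_of_real (r i W / 2 - Re (\<alpha> i (W - Z))) else 0)"
      using that by (intro sum.cong) (auto simp: e scaleR_conv_of_real)
    also have "\<dots> = complex_of_real (r i W / 2 - Re (\<alpha> i (W - Z)))" using that by simp
    finally show ?thesis by simp
  qed
  show ?thesis
  proof (rule derivative_zero_if_straightened[of "U \<inter> V" Z F u u' "{x. \<forall>j<d. Re (\<alpha> j x) = 0}"])
    fix W assume W: "W \<in> U \<inter> V" "F W - Z \<in> {x. \<forall>j<d. Re (\<alpha> j x) = 0}"
    then have "\<rho> j (W, cnj_vec W) = 0" if "j < d" for j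
      using F_\<alpha>[OF that, of W] that real_on_diagonal[OF that, of W] by (simp add: r_def complex_eq_iff)
    then show "u W = 0" using W(1) mem_iff zero by simp
  qed (use assms open_domain F' \<open>F Z = Z\<close> \<open>continuous_on U F\<close> v lin in
      \<open>auto simp: \<alpha>_def q_def linear_scale intro: continuous_on_subset\<close>)
qed

end

section \<open>Germs of smooth functions and vector fields\<close>

definition smooth_near :: "('a::real_normed_vector \<Rightarrow> 'b::real_normed_vector) \<Rightarrow> bool" where
  "smooth_near f \<longleftrightarrow> (\<exists>V. open V \<and> 0 \<in> V \<and> smooth_on f V)"

lemma smooth_on_cong: "open S \<Longrightarrow> (\<And>x. x \<in> S \<Longrightarrow> f x = g x) \<Longrightarrow> smooth_on f S \<Longrightarrow> smooth_on g S"
  unfolding smooth_on_def using times_differentiable_on_cong by blast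

lemma smooth_on_subset: "smooth_on f S \<Longrightarrow> T \<subseteq> S \<Longrightarrow> smooth_on f T"
  unfolding smooth_on_def using times_differentiable_on_subset by blast

lemma smooth_on_differentiable: "smooth_on f S \<Longrightarrow> x \<in> S \<Longrightarrow> f differentiable (at x)"
  unfolding smooth_on_def by (metis times_differentiable_on.simps(2))

lemma smooth_on_frechet_derivative:
  "smooth_on f S \<Longrightarrow> smooth_on (\<lambda>x. frechet_derivative f (at x) v) S"
  unfolding smooth_on_def by (metis times_differentiable_on.simps(2))

lemma smooth_on_const: "smooth_on (\<lambda>x. c) S"
  by (simp add: smooth_on_def times_differentiable_on_const)

lemma smooth_on_add: "open S \<Longrightarrow> smooth_on f S \<Longrightarrow> smooth_on g S \<Longrightarrow> smooth_on (\<lambda>x. f x + g x) S"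
  by (simp add: smooth_on_def times_differentiable_on_add)

lemma smooth_on_mult:
  fixes f g :: "'a::real_normed_vector \<Rightarrow> complex"
  shows "open S \<Longrightarrow> smooth_on f S \<Longrightarrow> smooth_on g S \<Longrightarrow> smooth_on (\<lambda>x. f x * g x) S"
  by (simp add: smooth_on_def times_differentiable_on_mult)

lemma smooth_on_sum:
  assumes "open S" "\<And>i. i \<in> I \<Longrightarrow> smooth_on (f i) S"
  shows "smooth_on (\<lambda>x. \<Sum>i\<in>I. f i x) S"
  using assms(2)
  by (induction I rule: infinite_finite_induct) (auto simp: smooth_on_const smooth_on_add assms(1))

lemma smooth_on_bounded_linear:
  "open S \<Longrightarrow> bounded_linear L \<Longrightarrow> smooth_on f S \<Longrightarrow> smooth_on (\<lambda>x. L (f x)) S"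
  by (simp add: smooth_on_def times_differentiable_on_bounded_linear)

lemma smooth_near_cong:
  assumes "\<forall>\<^sub>F x in nhds 0. f x = g x" "smooth_near f"
  shows "smooth_near g"
proof -
  obtain V where V: "open V" "0 \<in> V" "smooth_on f V"
    using assms(2) by (auto simp: smooth_near_def)
  obtain S where S: "open S" "0 \<in> S" "\<And>x. x \<in> S \<Longrightarrow> f x = g x"
    using assms(1) by (auto simp: eventually_nhds)
  have "smooth_on g (V \<inter> S)"
    using V S smooth_on_subset[OF V(3), of "V \<inter> S"] by (intro smooth_on_cong[of "V \<inter> S" f g]) auto
  then show ?thesis using V S by (auto simp: smooth_near_def)
qed

lemma smooth_near_common:
  assumes "smooth_near f" "smooth_near g"
  obtains V where "open V" "0 \<in> V" "smooth_on f V" "smooth_on g V"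
proof -
  obtain V W where "open V" "0 \<in> V" "smooth_on f V" "open W" "0 \<in> W" "smooth_on g W"
    using assms by (auto simp: smooth_near_def)
  then show ?thesis
    using that[of "V \<inter> W"] smooth_on_subset by (metis IntI inf_le1 inf_le2 open_Int)
qed

lemma smooth_near_const: "smooth_near (\<lambda>x. c)"
  unfolding smooth_near_def using smooth_on_const by blast

lemma smooth_near_add: "smooth_near f \<Longrightarrow> smooth_near g \<Longrightarrow> smooth_near (\<lambda>x. f x + g x)"
  by (metis smooth_near_common smooth_near_def smooth_on_add)

lemma smooth_near_mult:
  fixes f g :: "'a::real_normed_vector \<Rightarrow> complex"
  shows "smooth_near f \<Longrightarrow> smooth_near g \<Longrightarrow> smooth_near (\<lambda>x. f x * g x)"
  by (metis smooth_near_common smooth_near_def smooth_on_mult)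

lemma smooth_near_bounded_linear: "bounded_linear L \<Longrightarrow> smooth_near f \<Longrightarrow> smooth_near (\<lambda>x. L (f x))"
  unfolding smooth_near_def using smooth_on_bounded_linear by blast

lemma smooth_near_sum: "(\<And>i. i \<in> I \<Longrightarrow> smooth_near (f i)) \<Longrightarrow> smooth_near (\<lambda>x. \<Sum>i\<in>I. f i x)"
  by (induction I rule: infinite_finite_induct) (auto simp: smooth_near_const smooth_near_add)

lemma smooth_near_eventually_differentiable:
  "smooth_near f \<Longrightarrow> \<forall>\<^sub>F x in nhds 0. f differentiable (at x)"
  unfolding smooth_near_def eventually_nhds using smooth_on_differentiable by blast

lemma frechet_derivative_eventually_cong:
  assumes "\<forall>\<^sub>F y in nhds x. f y = g y"
  shows "frechet_derivative f (at x) = frechet_derivative g (at x)"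
proof -
  obtain S where S: "open S" "x \<in> S" "\<And>y. y \<in> S \<Longrightarrow> f y = g y"
    using assms by (auto simp: eventually_nhds)
  have "(f has_derivative D) (at x) \<longleftrightarrow> (g has_derivative D) (at x)" for D
    using has_derivative_transform_within_open[of f D x UNIV S g]
      has_derivative_transform_within_open[of g D x UNIV S f] S by metis
  then show ?thesis by (simp add: frechet_derivative_def)
qed

text \<open>The operators \<open>\<partial>/\<partial>Z\<^sub>k\<close> and \<open>\<partial>/\<partial>Zbar\<^sub>k\<close> as one family, indexed by a sum type, and the
  coefficients of a vector field in this frame.\<close>

fun wirtinger :: "'n + 'n \<Rightarrow> (complex^'n \<Rightarrow> complex) \<Rightarrow> complex^'n \<Rightarrow> complex" where
  "wirtinger (Inl k) = d_Z k"
| "wirtinger (Inr k) = d_Zbar k"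

fun vf_coeff :: "'n vfield \<Rightarrow> 'n + 'n \<Rightarrow> complex^'n \<Rightarrow> complex" where
  "vf_coeff X (Inl k) = (\<lambda>Z. fst (X Z) $ k)"
| "vf_coeff X (Inr k) = (\<lambda>Z. snd (X Z) $ k)"

lemma sum_UNIV_sum_type:
  fixes g :: "'n::finite + 'n \<Rightarrow> complex"
  shows "(\<Sum>c\<in>UNIV. g c) = (\<Sum>k\<in>UNIV. g (Inl k) + g (Inr k))"
  using sum.Plus[of "UNIV :: 'n set" "UNIV :: 'n set" g] by (simp add: sum.distrib o_def)

lemma vf_apply_eq_sum: "vf_apply X f Z = (\<Sum>c\<in>UNIV. vf_coeff X c Z * wirtinger c f Z)"
  by (simp add: vf_apply_def sum_UNIV_sum_type)

fun wirtinger_sign :: "'n + 'n \<Rightarrow> complex" where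
  "wirtinger_sign (Inl k) = -\<i>"
| "wirtinger_sign (Inr k) = \<i>"

fun wirtinger_axis :: "complex \<Rightarrow> 'n + 'n \<Rightarrow> complex^'n::finite" where
  "wirtinger_axis z (Inl k) = axis k z"
| "wirtinger_axis z (Inr k) = axis k z"

lemma wirtinger_eq:
  "wirtinger c f Z = 1/2 * (frechet_derivative f (at Z) (wirtinger_axis 1 c)
    + wirtinger_sign c * frechet_derivative f (at Z) (wirtinger_axis \<i> c))"
  by (cases c) (simp_all add: d_Z_def d_Zbar_def)

lemma wirtinger_const: "wirtinger c (\<lambda>Z. a) Z = 0"
  by (simp add: wirtinger_eq)

lemma wirtinger_add:
  assumes "f differentiable (at Z)" "g differentiable (at Z)"
  shows "wirtinger c (\<lambda>W. f W + g W) Z = wirtinger c f Z + wirtinger c g Z"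
  by (simp add: wirtinger_eq frechet_derivative_add[OF assms] algebra_simps)

lemma wirtinger_mult:
  assumes "f differentiable (at Z)" "g differentiable (at Z)"
  shows "wirtinger c (\<lambda>W. f W * g W) Z = f Z * wirtinger c g Z + wirtinger c f Z * g Z"
  by (simp add: wirtinger_eq frechet_derivative_mult_complex[OF assms] algebra_simps)

lemma smooth_on_wirtinger: "open S \<Longrightarrow> smooth_on f S \<Longrightarrow> smooth_on (wirtinger c f) S"
  unfolding wirtinger_eq[abs_def]
  by (intro smooth_on_mult smooth_on_add smooth_on_const smooth_on_frechet_derivative)

lemma smooth_on_vf_coeff:
  assumes "open S" "smooth_on X S"
  shows "smooth_on (vf_coeff X c) S"
proof (cases c)
  case (Inl k)
  then show ?thesis
    using smooth_on_bounded_linear[OF assms(1)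
        bounded_linear_compose[OF bounded_linear_vec_nth bounded_linear_fst] assms(2)] by simp
next
  case (Inr k)
  then show ?thesis
    using smooth_on_bounded_linear[OF assms(1)
        bounded_linear_compose[OF bounded_linear_vec_nth bounded_linear_snd] assms(2)] by simp
qed

lemma smooth_on_vf_apply: "open S \<Longrightarrow> smooth_on X S \<Longrightarrow> smooth_on f S \<Longrightarrow> smooth_on (vf_apply X f) S"
  unfolding vf_apply_eq_sum[abs_def]
  by (intro smooth_on_sum smooth_on_mult smooth_on_vf_coeff smooth_on_wirtinger)

lemma smooth_near_vf_coeff: "smooth_near X \<Longrightarrow> smooth_near (vf_coeff X c)"
  unfolding smooth_near_def using smooth_on_vf_coeff by blast

lemma smooth_near_wirtinger: "smooth_near f \<Longrightarrow> smooth_near (wirtinger c f)"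
  unfolding smooth_near_def using smooth_on_wirtinger by blast

lemma smooth_near_vf_apply: "smooth_near X \<Longrightarrow> smooth_near f \<Longrightarrow> smooth_near (vf_apply X f)"
  by (metis smooth_near_common smooth_near_def smooth_on_vf_apply)

lemma vf_apply_add:
  assumes "f differentiable (at Z)" "g differentiable (at Z)"
  shows "vf_apply X (\<lambda>W. f W + g W) Z = vf_apply X f Z + vf_apply X g Z"
  by (simp add: vf_apply_eq_sum wirtinger_add[OF assms] distrib_left sum.distrib)

lemma vf_apply_mult:
  assumes "f differentiable (at Z)" "g differentiable (at Z)"
  shows "vf_apply X (\<lambda>W. f W * g W) Z = f Z * vf_apply X g Z + vf_apply X f Z * g Z"
  by (simp add: vf_apply_eq_sum wirtinger_mult[OF assms] distrib_left sum.distrib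
      sum_distrib_left sum_distrib_right algebra_simps)

lemma vf_apply_const: "vf_apply X (\<lambda>W. a) Z = 0"
  by (simp add: vf_apply_eq_sum wirtinger_const)

lemma vf_apply_sum:
  assumes "finite I" "\<And>i. i \<in> I \<Longrightarrow> f i differentiable (at Z)"
  shows "vf_apply X (\<lambda>W. \<Sum>i\<in>I. f i W) Z = (\<Sum>i\<in>I. vf_apply X (f i) Z)"
  using assms by (induction I rule: finite_induct) (auto simp: vf_apply_const vf_apply_add)

lemma vf_apply_eventually_cong:
  assumes "\<forall>\<^sub>F x in nhds 0. f x = g x"
  shows "\<forall>\<^sub>F x in nhds 0. vf_apply X f x = vf_apply X g x"
  using iffD2[OF eventually_eventually assms]
proof eventually_elim
  case (elim Z)
  then show ?case
    by (simp add: vf_apply_eq_sum wirtinger_eq frechet_derivative_eventually_cong[OF elim])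
qed

text \<open>Both operators are combinations with constant coefficients of real directional derivatives, which
  commute.\<close>

lemma wirtinger_commute:
  assumes "open S" "smooth_on f S" "Z \<in> S"
  shows "wirtinger b (wirtinger c f) Z = wirtinger c (wirtinger b f) Z"
proof -
  define D where "D = (\<lambda>v w. frechet_derivative (\<lambda>y. frechet_derivative f (at y) v) (at Z) w)"
  have sym: "D v w = D w v" for v w
    unfolding D_def using second_derivative_symmetric[OF assms(1,3)] assms(2) by (simp add: smooth_on_def)
  have diff: "(\<lambda>y. frechet_derivative f (at y) v) differentiable (at Z)" for v
    using smooth_on_differentiable[OF smooth_on_frechet_derivative[OF assms(2)] assms(3)] .
  have "frechet_derivative (wirtinger c f) (at Z) w
      = 1/2 * (D (wirtinger_axis 1 c) w + wirtinger_sign c * D (wirtinger_axis \<i> c) w)" for c w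
    unfolding wirtinger_eq[abs_def] D_def
    by (subst frechet_derivative_mult_complex | subst frechet_derivative_add
        | intro differentiable_add differentiable_mult differentiable_const diff | simp)+
  then show ?thesis
    unfolding wirtinger_eq[of _ "wirtinger _ f"]
    using sym by (simp add: algebra_simps)
qed

lemma vf_coeff_lie_bracket:
  "vf_coeff (lie_bracket X Y) c Z = vf_apply X (vf_coeff Y c) Z - vf_apply Y (vf_coeff X c) Z"
  by (cases c) (simp_all add: lie_bracket_def)

text \<open>The second-order terms of the two compositions agree since the frame of coordinate derivatives
  commutes; the derivatives of the coefficients remain.\<close>

lemma vf_apply_lie_bracket:
  assumes "open S" "smooth_on X S" "smooth_on Y S" "smooth_on f S" "Z \<in> S"
  shows "vf_apply (lie_bracket X Y) f Z = vf_apply X (vf_apply Y f) Z - vf_apply Y (vf_apply X f) Z"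
proof -
  have diff: "vf_coeff W c differentiable (at Z)" "wirtinger c f differentiable (at Z)"
    if "smooth_on W S" for W c
    using assms that by (auto intro: smooth_on_differentiable smooth_on_vf_coeff smooth_on_wirtinger)
  have iterate: "vf_apply V (vf_apply W f) Z = (\<Sum>c\<in>UNIV. vf_apply V (vf_coeff W c) Z * wirtinger c f Z)
      + (\<Sum>c\<in>UNIV. \<Sum>b\<in>UNIV. vf_coeff W c Z * vf_coeff V b Z * wirtinger b (wirtinger c f) Z)"
    if "smooth_on V S" "smooth_on W S" for V W
  proof -
    have "vf_apply V (vf_apply W f) Z = vf_apply V (\<lambda>Z. \<Sum>c\<in>UNIV. vf_coeff W c Z * wirtinger c f Z) Z"
      by (simp add: vf_apply_eq_sum[abs_def])
    also have "\<dots> = (\<Sum>c\<in>UNIV. vf_apply V (\<lambda>Z. vf_coeff W c Z * wirtinger c f Z) Z)"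
      by (rule vf_apply_sum) (use diff that in auto)
    also have "\<dots> = (\<Sum>c\<in>UNIV. vf_coeff W c Z * vf_apply V (wirtinger c f) Z
        + vf_apply V (vf_coeff W c) Z * wirtinger c f Z)"
      by (rule sum.cong[OF refl], rule vf_apply_mult) (use diff that in auto)
    finally show ?thesis
      by (simp add: sum.distrib vf_apply_eq_sum[of V "wirtinger _ f"] sum_distrib_left mult.assoc)
  qed
  have "(\<Sum>c\<in>UNIV. \<Sum>b\<in>UNIV. vf_coeff Y c Z * vf_coeff X b Z * wirtinger b (wirtinger c f) Z)
      = (\<Sum>c\<in>UNIV. \<Sum>b\<in>UNIV. vf_coeff X c Z * vf_coeff Y b Z * wirtinger b (wirtinger c f) Z)"
    by (subst sum.swap) (simp add: wirtinger_commute[OF assms(1,4,5)] mult_ac)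
  then show ?thesis
    unfolding iterate[OF assms(2,3)] iterate[OF assms(3,2)]
    by (simp add: vf_apply_eq_sum[of "lie_bracket X Y"] vf_coeff_lie_bracket left_diff_distrib
        sum_subtractf)
qed

lemma smooth_on_lie_bracket:
  fixes X Y :: "('n::finite) vfield"
  assumes "open S" "smooth_on X S" "smooth_on Y S"
  shows "smooth_on (lie_bracket X Y) S"
proof -
  define c where "c = (\<lambda>b Z. vf_apply X (vf_coeff Y b) Z - vf_apply Y (vf_coeff X b) Z)"
  have c: "smooth_on (c b) S" for b
  proof -
    have "smooth_on (\<lambda>Z. vf_apply X (vf_coeff Y b) Z + (-1) * vf_apply Y (vf_coeff X b) Z) S"
      using assms by (intro smooth_on_add smooth_on_mult smooth_on_const smooth_on_vf_apply smooth_on_vf_coeff)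
    then show ?thesis by (simp add: c_def)
  qed
  have lin: "linear (axis k :: complex \<Rightarrow> complex^'n)" for k :: 'n
    by (rule linearI) (simp_all add: axis_def vec_eq_iff)
  have basis: "bounded_linear (\<lambda>z. (axis k z, 0) :: (complex^'n) \<times> (complex^'n))"
    "bounded_linear (\<lambda>z. (0, axis k z) :: (complex^'n) \<times> (complex^'n))" for k :: 'n
    by (intro bounded_linear_Pair bounded_linear_zero linear_linear[THEN iffD2] lin)+
  have sum_axis: "(\<Sum>k\<in>UNIV. axis k (a k)) = vec_lambda a" for a :: "'n \<Rightarrow> complex"
    by (simp add: vec_eq_iff axis_def if_distrib[of "\<lambda>f. f _"] cong: if_cong)
  have "lie_bracket X Y Z = (\<Sum>k\<in>UNIV. (axis k (c (Inl k) Z), 0) + (0, axis k (c (Inr k) Z)))" for Z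
    unfolding lie_bracket_def c_def prod_eq_iff fst_sum snd_sum by (simp add: sum_axis)
  moreover have "smooth_on (\<lambda>Z. \<Sum>k\<in>UNIV. (axis k (c (Inl k) Z), 0) + (0, axis k (c (Inr k) Z))) S"
    by (rule smooth_on_sum[OF assms(1)], rule smooth_on_add[OF assms(1)];
        rule smooth_on_bounded_linear[OF assms(1) _ c], rule basis)
  ultimately show ?thesis by presburger
qed

lemma smooth_near_lie_bracket:
  fixes X Y :: "('n::finite) vfield"
  shows "smooth_near X \<Longrightarrow> smooth_near Y \<Longrightarrow> smooth_near (lie_bracket X Y)"
  by (metis smooth_near_common smooth_near_def smooth_on_lie_bracket)

lemma smooth_near_cnj: "smooth_near f \<Longrightarrow> smooth_near (\<lambda>x. cnj (f x))"
  by (rule smooth_near_bounded_linear[OF bounded_linear_cnj])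

section \<open>Flatness along a family of vector fields\<close>

text \<open>Vanishing at 0 of all derivatives along fewer than \<open>n\<close> fields of \<open>F\<close>. Order 0 asks only for
  smoothness, so that multiplication by a function vanishing at 0 raises the order by one.\<close>

primrec flat :: "('n::finite) vfield set \<Rightarrow> nat \<Rightarrow> (complex^'n \<Rightarrow> complex) \<Rightarrow> bool" where
  "flat F 0 u \<longleftrightarrow> smooth_near u"
| "flat F (Suc n) u \<longleftrightarrow> smooth_near u \<and> u 0 = 0 \<and> (\<forall>X\<in>F. flat F n (vf_apply X u))"

lemma flat_imp_smooth_near: "flat F n u \<Longrightarrow> smooth_near u"
  by (cases n) auto

locale smooth_fields =
  fixes F :: "('n::finite) vfield set"
  assumes smooth: "X \<in> F \<Longrightarrow> smooth_near X"
begin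

lemma flat_SucD: "flat F (Suc n) u \<Longrightarrow> flat F n u"
proof (induction n arbitrary: u)
  case (Suc n)
  then show ?case by (metis flat.simps(2))
qed simp

lemma flat_cong:
  assumes "\<forall>\<^sub>F Z in nhds 0. u Z = v Z" "flat F n u"
  shows "flat F n v"
  using assms
proof (induction n arbitrary: u v)
  case 0
  then show ?case using smooth_near_cong by auto
next
  case (Suc n)
  have "flat F n (vf_apply X v)" if "X \<in> F" for X
    using Suc.IH[OF vf_apply_eventually_cong[OF Suc.prems(1)]] Suc.prems(2) that by simp
  then show ?case
    using Suc.prems smooth_near_cong eventually_nhds_x_imp_x[OF Suc.prems(1)] by auto
qed

lemma vf_apply_add_near:
  assumes "smooth_near u" "smooth_near v"
  shows "\<forall>\<^sub>F Z in nhds 0. vf_apply X u Z + vf_apply X v Z = vf_apply X (\<lambda>Z. u Z + v Z) Z"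
  using smooth_near_eventually_differentiable[OF assms(1)]
    smooth_near_eventually_differentiable[OF assms(2)]
  by eventually_elim (simp add: vf_apply_add)

lemma vf_apply_mult_near:
  assumes "smooth_near u" "smooth_near v"
  shows "\<forall>\<^sub>F Z in nhds 0. u Z * vf_apply X v Z + vf_apply X u Z * v Z = vf_apply X (\<lambda>Z. u Z * v Z) Z"
  using smooth_near_eventually_differentiable[OF assms(1)]
    smooth_near_eventually_differentiable[OF assms(2)]
  by eventually_elim (simp add: vf_apply_mult)

lemma flat_zero: "flat F n (\<lambda>Z. 0)"
  by (induction n) (simp_all add: smooth_near_const vf_apply_const[abs_def])

lemma flat_add: "flat F n u \<Longrightarrow> flat F n v \<Longrightarrow> flat F n (\<lambda>Z. u Z + v Z)"
proof (induction n arbitrary: u v)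
  case 0
  then show ?case by (simp add: smooth_near_add)
next
  case (Suc n)
  have "flat F n (vf_apply X (\<lambda>Z. u Z + v Z))" if "X \<in> F" for X
    using Suc that by (intro flat_cong[OF vf_apply_add_near] Suc.IH) auto
  then show ?case using Suc.prems by (simp add: smooth_near_add)
qed

lemma flat_sum: "(\<And>i. i \<in> I \<Longrightarrow> flat F n (u i)) \<Longrightarrow> flat F n (\<lambda>Z. \<Sum>i\<in>I. u i Z)"
  by (induction I rule: infinite_finite_induct) (auto simp: flat_zero flat_add)

lemma flat_mult: "smooth_near a \<Longrightarrow> flat F n u \<Longrightarrow> flat F n (\<lambda>Z. a Z * u Z)"
proof (induction n arbitrary: a u)
  case 0
  then show ?case by (simp add: smooth_near_mult)
next
  case (Suc n)
  have "flat F n (vf_apply X (\<lambda>Z. a Z * u Z))" if "X \<in> F" for X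
    using Suc.prems that flat_SucD
    by (intro flat_cong[OF vf_apply_mult_near] flat_add Suc.IH smooth_near_vf_apply smooth) auto
  then show ?case using Suc.prems by (simp add: smooth_near_mult)
qed

text \<open>In \<open>X (a u) = a (X u) + (X a) u\<close> the second term has the order of \<open>u\<close>, and the first one has it by
  induction, since its factor \<open>a\<close> makes up for the order lost in \<open>X u\<close>.\<close>

lemma flat_mult_vanishing:
  "smooth_near a \<Longrightarrow> a 0 = 0 \<Longrightarrow> flat F n u \<Longrightarrow> flat F (Suc n) (\<lambda>Z. a Z * u Z)"
proof (induction n arbitrary: u)
  case 0
  have "flat F 0 (vf_apply X (\<lambda>Z. a Z * u Z))" if "X \<in> F" for X
    using 0 that smooth by (simp add: smooth_near_vf_apply smooth_near_mult)
  then show ?case using 0 by (simp add: smooth_near_mult)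
next
  case (Suc n)
  have "flat F (Suc n) (vf_apply X (\<lambda>Z. a Z * u Z))" if "X \<in> F" for X
  proof (rule flat_cong[OF vf_apply_mult_near flat_add])
    show "flat F (Suc n) (\<lambda>Z. a Z * vf_apply X u Z)"
      using Suc that by simp
    show "flat F (Suc n) (\<lambda>Z. vf_apply X a Z * u Z)"
      using Suc.prems that smooth by (intro flat_mult smooth_near_vf_apply) auto
  qed (use Suc.prems in auto)
  then show ?case using Suc.prems by (simp add: smooth_near_mult)
qed

text \<open>A matrix of smooth functions that is the identity at 0 acts invertibly modulo flatness. Its
  difference from the identity raises the order of flatness by one, so that induction on the order
  takes the place of inverting the matrix.\<close>

lemma flat_of_identity_matrix_mult:
  fixes T :: "'k::finite \<Rightarrow> 'k \<Rightarrow> complex^'n \<Rightarrow> complex"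
  assumes T: "\<And>j k. smooth_near (T j k)" "\<And>j k. T j k 0 = (if j = k then 1 else 0)"
    and u: "\<And>j. smooth_near (u j)" and v: "\<And>j. flat F n (\<lambda>Z. \<Sum>k\<in>UNIV. T j k Z * u k Z)"
  shows "flat F n (u j)"
  using v
proof (induction n arbitrary: j)
  case 0
  then show ?case using u by simp
next
  case (Suc n)
  have "flat F n (u k)" for k
    using Suc flat_SucD by blast
  moreover have "smooth_near (\<lambda>Z. (if j = k then 1 else 0) + (-1) * T j k Z)" for k
    using T by (intro smooth_near_add smooth_near_mult smooth_near_const)
  ultimately have diff: "flat F (Suc n) (\<lambda>Z. \<Sum>k\<in>UNIV. ((if j = k then 1 else 0) + (-1) * T j k Z) * u k Z)"
    by (intro flat_sum flat_mult_vanishing) (simp_all add: T)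
  have eq: "(\<Sum>k\<in>UNIV. T j k Z * u k Z)
      + (\<Sum>k\<in>UNIV. ((if j = k then 1 else 0) + (-1) * T j k Z) * u k Z) = u j Z" for Z
    by (simp add: left_diff_distrib sum_subtractf if_distrib[of "\<lambda>x. x * _"] cong: if_cong)
  from flat_add[OF Suc.prems[of j] diff] show ?case unfolding eq .
qed

end

section \<open>The Lie algebra of a submanifold\<close>

text \<open>A complexified tangent vector \<open>(a, b)\<close> of \<open>C^n\<close> is a combination \<open>v + \<i> w\<close> of two real ones, with
  \<open>v = (a + bbar) / 2\<close> and \<open>w = (a - bbar) / (2 \<i>)\<close>.\<close>

lemma vf_apply_eq_real_derivatives:
  assumes "(u has_derivative u') (at Z)"
  shows "vf_apply X u Z = u' ((1/2) *s (fst (X Z) + cnj_vec (snd (X Z))))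
    + \<i> * u' ((-\<i>/2) *s (fst (X Z) - cnj_vec (snd (X Z))))"
proof -
  interpret u': linear u' using assms by (rule has_derivative_linear)
  have expand: "u' v = (\<Sum>k\<in>UNIV. Re (v $ k) * u' (axis k 1) + Im (v $ k) * u' (axis k \<i>))" for v
  proof -
    have "(\<Sum>k\<in>UNIV. Re (v $ k) *\<^sub>R axis k 1 + Im (v $ k) *\<^sub>R axis k \<i>) $ i
        = (\<Sum>k\<in>UNIV. if i = k then v $ k else 0)" for i
      unfolding sum_component by (rule sum.cong) (auto simp: axis_def complex_eq_iff)
    then have "v = (\<Sum>k\<in>UNIV. Re (v $ k) *\<^sub>R axis k 1 + Im (v $ k) *\<^sub>R axis k \<i>)"
      by (simp add: vec_eq_iff)
    from arg_cong[OF this, of u'] show ?thesis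
      by (simp only: u'.sum u'.add u'.scale scaleR_conv_of_real[where 'a = complex])
  qed
  have summand: "a * ((p - \<i> * q) / 2) + b * ((p + \<i> * q) / 2)
      = Re ((1/2) * (a + cnj b)) * p + Im ((1/2) * (a + cnj b)) * q
      + \<i> * (Re ((-\<i>/2) * (a - cnj b)) * p + Im ((-\<i>/2) * (a - cnj b)) * q)" for a b p q :: complex
    by (simp add: complex_eq_iff field_simps)
  show ?thesis
    unfolding vf_apply_def d_Z_def d_Zbar_def frechet_derivative_eqI[OF assms] summand
      expand[of "_ *s _"] vector_smult_component vector_add_component vector_minus_component
      cnj_vec_nth
    by (simp only: sum.distrib sum_distrib_left[symmetric])
qed

definition tangential_fields ::
  "(complex^'n) set \<Rightarrow> nat \<Rightarrow> (nat \<Rightarrow> (complex^'n) \<times> (complex^'n) \<Rightarrow> complex) \<Rightarrow> ('n::finite) vfield set"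
  where "tangential_fields M d \<rho> = {X. tangent_field_near M d \<rho> 0 {w. snd w = 0} X
    \<or> tangent_field_near M d \<rho> 0 {w. fst w = 0} X}"

lemma tangent_field_smooth_near: "tangent_field_near M d \<rho> 0 T X \<Longrightarrow> smooth_near X"
  unfolding tangent_field_near_def smooth_near_def by blast

lemma tangent_field_eventually:
  "tangent_field_near M d \<rho> 0 T X \<Longrightarrow> \<forall>\<^sub>F Z in nhds 0. Z \<in> M \<longrightarrow> X Z \<in> complex_tangent d \<rho> Z \<inter> T"
  unfolding tangent_field_near_def eventually_nhds by blast

locale manifold_through_0 = generic_manifold M d \<rho> U
  for M :: "(complex^'n) set" and d \<rho> U +
  assumes zero_mem: "0 \<in> M"
begin

abbreviation "fields \<equiv> tangential_fields M d \<rho>"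

sublocale smooth_fields fields
  by unfold_locales (auto simp: tangential_fields_def intro: tangent_field_smooth_near)

lemma zero_in_U: "0 \<in> U"
  using generic by (simp add: generic_submanifold_def)

text \<open>The complexified tangent space of \<open>M\<close> is invariant under conjugation, so the two real vectors of
  which \<open>X Z\<close> is composed are tangent to \<open>M\<close> as well.\<close>

lemma tangent_vector_annihilates:
  assumes "Z \<in> M" "Z \<in> U" "open V" "Z \<in> V" and zero: "\<And>W. W \<in> M \<inter> V \<Longrightarrow> u W = 0"
    and u: "u differentiable (at Z)" and X: "X Z \<in> complex_tangent d \<rho> Z"
  shows "vf_apply X u Z = 0"
proof -
  define u' where "u' = frechet_derivative u (at Z)"
  have u': "(u has_derivative u') (at Z)" using u by (simp add: u'_def frechet_derivative_works)
  define a where "a = fst (X Z)"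
  define b where "b = cnj_vec (snd (X Z))"
  define q where "q = (Z, cnj_vec Z)"
  have q: "q \<in> U \<times> cnj_vec ` U" using assms by (simp add: q_def)
  have sum_zero: "dZ (\<rho> j) q a + cnj (dZ (\<rho> j) q b) = 0" if "j < d" for j
  proof -
    have "frechet_derivative (\<rho> j) (at q) (a, cnj_vec b) = 0"
      using X that by (simp add: complex_tangent_def a_def b_def q_def)
    then show ?thesis
      using derivative_split[OF that q, of a "cnj_vec b"]
        derivative_cnj[OF that \<open>Z \<in> U\<close>, of 0 "cnj_vec b"] by (simp add: dZ_def q_def)
  qed
  have "u' v = 0" if "\<And>j. j < d \<Longrightarrow> Re (dZ (\<rho> j) q v) = 0" for v
    using real_tangent_derivative_zero[OF assms(1-5) u'] that by (simp add: q_def)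
  moreover have "Re (dZ (\<rho> j) q ((1/2) *s (a + b))) = 0" "Re (dZ (\<rho> j) q ((-\<i>/2) *s (a - b))) = 0"
    if "j < d" for j
    unfolding linear_dZ(2)[OF that q] linear_add[OF linear_dZ(1)[OF that q]]
      linear_diff[OF linear_dZ(1)[OF that q]]
    using sum_zero[OF that] by (auto simp: complex_eq_iff)
  ultimately show ?thesis
    unfolding vf_apply_eq_real_derivatives[OF u'] a_def[symmetric] b_def[symmetric] by simp
qed

lemma vf_apply_vanishing:
  assumes "smooth_near u" "\<forall>\<^sub>F Z in nhds 0. Z \<in> M \<longrightarrow> u Z = 0" "X \<in> fields"
  shows "\<forall>\<^sub>F Z in nhds 0. Z \<in> M \<longrightarrow> vf_apply X u Z = 0"
proof -
  obtain V where V: "open V" "0 \<in> V" "\<And>Z. Z \<in> V \<Longrightarrow> Z \<in> M \<Longrightarrow> u Z = 0"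
    using assms(2) by (auto simp: eventually_nhds)
  have "\<forall>\<^sub>F Z in nhds 0. Z \<in> U \<inter> V"
    using V open_domain zero_in_U by (intro eventually_nhds_in_open) auto
  moreover have "\<forall>\<^sub>F Z in nhds 0. Z \<in> M \<longrightarrow> X Z \<in> complex_tangent d \<rho> Z"
    using assms(3) unfolding tangential_fields_def
    by (auto dest!: tangent_field_eventually elim: eventually_mono)
  ultimately show ?thesis
    using smooth_near_eventually_differentiable[OF assms(1)]
    by eventually_elim (use V in \<open>auto intro!: tangent_vector_annihilates\<close>)
qed

lemma flat_if_vanishing:
  assumes "smooth_near u" "\<forall>\<^sub>F Z in nhds 0. Z \<in> M \<longrightarrow> u Z = 0"
  shows "flat fields n u"
  using assms
proof (induction n arbitrary: u)
  case 0
  then show ?case by simp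
next
  case (Suc n)
  have "u 0 = 0" using eventually_nhds_x_imp_x[OF Suc.prems(2)] zero_mem by simp
  moreover have "flat fields n (vf_apply X u)" if "X \<in> fields" for X
    using Suc that by (intro Suc.IH smooth_near_vf_apply smooth vf_apply_vanishing)
  ultimately show ?case using Suc.prems by simp
qed

lemma lie_algebra_smooth_near: "X \<in> lie_algebra M d \<rho> 0 \<Longrightarrow> smooth_near X"
proof (induction rule: lie_algebra.induct)
  case (scale X c)
  then show ?case
    using smooth_near_bounded_linear[OF pair_structure.bounded_linear_right] by blast
qed (auto intro: tangent_field_smooth_near smooth_near_add smooth_near_lie_bracket)

text \<open>Functions that are flat of every order are by definition preserved by the generating fields, and
  on them the operations of the Lie algebra are sums, multiples and commutators of operators.\<close>

lemma flat_vf_apply_lie_algebra: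
  assumes "X \<in> lie_algebra M d \<rho> 0" "\<And>n. flat fields n u"
  shows "flat fields n (vf_apply X u)"
  using assms
proof (induction arbitrary: u n rule: lie_algebra.induct)
  case (type_10 X)
  then show ?case by (metis (mono_tags) CollectI flat.simps(2) tangential_fields_def)
next
  case (type_01 X)
  then show ?case by (metis (mono_tags) CollectI flat.simps(2) tangential_fields_def)
next
  case (add X Y)
  have "vf_apply (\<lambda>Z. X Z + Y Z) u = (\<lambda>Z. vf_apply X u Z + vf_apply Y u Z)"
    by (simp add: fun_eq_iff vf_apply_def algebra_simps sum.distrib)
  then show ?case using add by (simp add: flat_add)
next
  case (scale X c)
  have "vf_apply (\<lambda>Z. pair_scale c (X Z)) u = (\<lambda>Z. c * vf_apply X u Z)"
    by (simp add: fun_eq_iff vf_apply_def pair_scale_def algebra_simps sum_distrib_left)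
  then show ?case using scale by (simp add: flat_mult smooth_near_const)
next
  case (bracket X Y)
  have "flat fields n (\<lambda>Z. vf_apply X (vf_apply Y u) Z + (-1) * vf_apply Y (vf_apply X u) Z)"
    using bracket by (intro flat_add flat_mult smooth_near_const) auto
  moreover have "\<forall>\<^sub>F Z in nhds 0. vf_apply X (vf_apply Y u) Z + (-1) * vf_apply Y (vf_apply X u) Z
      = vf_apply (lie_bracket X Y) u Z"
  proof -
    have "smooth_near u" using bracket.prems[of 0] by simp
    obtain V where V: "open V" "0 \<in> V" "smooth_on X V" "smooth_on Y V"
      using smooth_near_common[of X Y] lie_algebra_smooth_near bracket.hyps by metis
    obtain W where W: "open W" "0 \<in> W" "smooth_on u W"
      using \<open>smooth_near u\<close> by (auto simp: smooth_near_def)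
    have "\<forall>\<^sub>F Z in nhds 0. Z \<in> V \<inter> W"
      using V W by (intro eventually_nhds_in_open) auto
    then show ?thesis
    proof eventually_elim
      case (elim Z)
      then show ?case
        using vf_apply_lie_bracket[OF open_Int[OF V(1) W(1)] smooth_on_subset[OF V(3)]
            smooth_on_subset[OF V(4)] smooth_on_subset[OF W(3)]] by simp
    qed
  qed
  ultimately show ?case by (rule flat_cong[rotated])
qed

end

section \<open>Holomorphic functions and flatness\<close>

lemma d_Z_holomorphic:
  assumes "holomorphic_map_on (*s) (*) u S" "Z \<in> S"
  shows "d_Z k u Z = frechet_derivative u (at Z) (axis k 1)"
    and "d_Zbar k u Z = 0"
    and "d_Z k (\<lambda>Z. cnj (u Z)) Z = 0"
proof -
  have "axis k \<i> = \<i> *s (axis k 1 :: complex^'a)"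
    by (simp add: vec_eq_iff axis_def)
  then have i: "frechet_derivative u (at Z) (axis k \<i>) = \<i> * frechet_derivative u (at Z) (axis k 1)"
    using assms unfolding vec_structure.holomorphic_map_on_iff by metis
  have "u differentiable (at Z)"
    using assms unfolding vec_structure.holomorphic_map_on_iff by blast
  then have c: "frechet_derivative (\<lambda>Z. cnj (u Z)) (at Z) v = cnj (frechet_derivative u (at Z) v)" for v
    using frechet_derivative_bounded_linear_comp[OF bounded_linear_cnj] by metis
  show "d_Z k u Z = frechet_derivative u (at Z) (axis k 1)" "d_Zbar k u Z = 0"
    "d_Z k (\<lambda>Z. cnj (u Z)) Z = 0"
    by (simp_all add: d_Z_def d_Zbar_def i c algebra_simps)
qed

lemma holomorphic_imp_smooth_near:
  assumes "open S" "0 \<in> S" "holomorphic_map_on (*s) (*) u S"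
  shows "smooth_near u"
  using vec_structure.holomorphic_map_on_imp_times_differentiable_on[OF assms(1,3)] assms
  unfolding smooth_near_def smooth_on_def by blast

text \<open>On a complex line through 0 the iterated derivatives of \<open>u\<close> at 0 are values at 0 of iterated
  directional derivatives, which belong to \<open>\<F>\<close> again. So \<open>u\<close> vanishes on each such line near 0.\<close>

lemma holomorphic_zero_if_derivatives_closed:
  fixes \<F> :: "(complex^'n::finite \<Rightarrow> complex) set"
  assumes \<F>: "\<And>u v. u \<in> \<F> \<Longrightarrow> (\<lambda>Z. frechet_derivative u (at Z) v) \<in> \<F>" "\<And>u. u \<in> \<F> \<Longrightarrow> u 0 = 0"
    and hol: "\<And>u. u \<in> \<F> \<Longrightarrow> holomorphic_map_on (*s) (*) u S" and "open S" "0 \<in> S" "u \<in> \<F>"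
  shows "\<forall>\<^sub>F Z in nhds 0. u Z = 0"
proof -
  obtain r where r: "0 < r" "ball 0 r \<subseteq> S"
    using \<open>open S\<close> \<open>0 \<in> S\<close> open_contains_ball by blast
  have norm: "norm (w *s (Z :: complex^'n)) = norm w * norm Z" for w Z
    by (simp add: norm_vec_def L2_set_right_distrib norm_mult)
  have "u z = 0" if z: "z \<in> ball 0 r" for z
  proof -
    \<comment> \<open>The disc of radius \<open>\<epsilon> > 1\<close> is chosen such that it contains 1 and \<open>w *s z\<close> stays in the ball.\<close>
    define m where "m = (norm z + r) / 2"
    have m: "norm z < m" "m < r" "0 < m" using z r(1) by (simp_all add: m_def add_nonneg_pos)
    define \<epsilon> where "\<epsilon> = r / m"
    have \<epsilon>: "1 < \<epsilon>" "\<epsilon> * m = r" using m by (simp_all add: \<epsilon>_def)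
    have inS: "w *s z \<in> S" if "w \<in> ball 0 \<epsilon>" for w
    proof -
      have "norm w * norm z \<le> \<epsilon> * norm z" using that by (intro mult_right_mono) auto
      also have "\<dots> < \<epsilon> * m"
        using m(1) \<epsilon>(1) by (intro mult_strict_left_mono) auto
      finally show ?thesis using r(2) \<epsilon>(2) by (auto simp: norm)
    qed
    define D where "D = (\<lambda>(v :: complex^'n \<Rightarrow> complex) Z. frechet_derivative v (at Z) z)"
    have deriv: "((\<lambda>w. v (w *s z)) has_field_derivative D v (w *s z)) (at w)"
      if "v \<in> \<F>" "w \<in> ball 0 \<epsilon>" for v w
      using vec_structure.field_derivative_on_line[OF hol[OF that(1)], of 0 w z] inS[OF that(2)]
      by (simp add: D_def)
    have iter: "(D ^^ n) u \<in> \<F>" for n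
      by (induction n) (use \<open>u \<in> \<F>\<close> \<F>(1) in \<open>auto simp: D_def\<close>)
    have deriv_iter: "(deriv ^^ n) (\<lambda>w. u (w *s z)) w = (D ^^ n) u (w *s z)" if "w \<in> ball 0 \<epsilon>" for n w
      using that
    proof (induction n arbitrary: w)
      case (Suc n)
      have "\<forall>\<^sub>F w' in nhds w. w' \<in> ball 0 \<epsilon>"
        using Suc.prems by (intro eventually_nhds_in_open) auto
      then have "\<forall>\<^sub>F w' in nhds w. (deriv ^^ n) (\<lambda>w. u (w *s z)) w' = (D ^^ n) u (w' *s z)"
        by eventually_elim (rule Suc.IH)
      then have "(deriv ^^ Suc n) (\<lambda>w. u (w *s z)) w = deriv (\<lambda>w. (D ^^ n) u (w *s z)) w"
        by (simp add: deriv_cong_ev)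
      also have "\<dots> = (D ^^ Suc n) u (w *s z)"
        using DERIV_imp_deriv[OF deriv[OF iter Suc.prems]] by simp
      finally show ?case .
    qed simp
    have "u (1 *s z) = 0"
    proof (rule holomorphic_fun_eq_0_on_connected[of "\<lambda>w. u (w *s z)" "ball 0 \<epsilon>" 0])
      show "(\<lambda>w. u (w *s z)) holomorphic_on ball 0 \<epsilon>"
        unfolding holomorphic_on_open[OF open_ball] using deriv[OF \<open>u \<in> \<F>\<close>] by blast
      show "(deriv ^^ n) (\<lambda>w. u (w *s z)) 0 = 0" for n
        using deriv_iter[of 0 n] \<F>(2)[OF iter] \<epsilon> by simp
    qed (use \<epsilon> in auto)
    then show ?thesis by simp
  qed
  then show ?thesis
    using eventually_nhds_in_open[OF open_ball, of 0 0 r] r(1) by (auto elim: eventually_mono)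
qed

context manifold_through_0
begin

text \<open>Genericity: the \<open>\<partial>\<^sub>\<zeta> \<rho> j\<close> are independent as well, by the reality condition, so \<open>b\<close> can be solved
  for in the equations of the complexified tangent space.\<close>

lemma conjugate_direction:
  obtains b where "(a, b) \<in> complex_tangent d \<rho> 0"
proof -
  have q: "(0, cnj_vec 0) \<in> U \<times> cnj_vec ` U" using in_domain[OF zero_in_U] .
  obtain e where e: "\<And>i j. i < d \<Longrightarrow> j < d \<Longrightarrow> dZ (\<rho> i) (0, cnj_vec 0) (e j) = (if i = j then 1 else 0)"
    using dual_vectors[OF q] by blast
  define b where "b = (\<Sum>j<d. (- cnj (dZ (\<rho> j) (0, cnj_vec 0) a)) *s e j)"
  have "frechet_derivative (\<rho> i) (at (0, cnj_vec 0)) (a, cnj_vec b) = 0" if "i < d" for i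
  proof -
    have "dZ (\<rho> i) (0, cnj_vec 0) b
        = (\<Sum>j<d. (- cnj (dZ (\<rho> j) (0, cnj_vec 0) a)) * (if i = j then 1 else 0))"
      unfolding b_def linear_sum[OF linear_dZ(1)[OF that q]] linear_dZ(2)[OF that q]
      using that e by (intro sum.cong) auto
    also have "\<dots> = - cnj (dZ (\<rho> i) (0, cnj_vec 0) a)"
      using that by (simp add: if_distrib[of "\<lambda>x. _ * x"] cong: if_cong)
    finally show ?thesis
      using derivative_split[OF that q, of a "cnj_vec b"]
        derivative_cnj[OF that zero_in_U, of 0 "cnj_vec b"] by (simp add: dZ_def)
  qed
  then have "(a, cnj_vec b) \<in> complex_tangent d \<rho> 0" by (simp add: complex_tangent_def)
  then show ?thesis by (rule that)
qed

text \<open>Fields of the Lie algebra whose \<open>(1,0)\<close> parts at 0 are the coordinate vectors exist by finite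
  type. They act on holomorphic functions as a matrix that is the identity at 0, applied to the
  coordinate derivatives.\<close>

lemma flat_d_Z:
  assumes ft: "finite_type_at M d \<rho> 0" and "open S" "0 \<in> S" "holomorphic_map_on (*s) (*) u S"
    and flat: "\<And>n. flat fields n u"
  shows "flat fields n (d_Z k u)"
proof -
  have "\<exists>X \<in> lie_algebra M d \<rho> 0. fst (X 0) = axis l 1" for l
  proof -
    obtain b where "(axis l 1, b) \<in> complex_tangent d \<rho> 0"
      using conjugate_direction by blast
    then have "(axis l 1, b) \<in> (\<lambda>X. X 0) ` lie_algebra M d \<rho> 0"
      using ft by (simp add: finite_type_at_def)
    then obtain X where X: "X \<in> lie_algebra M d \<rho> 0" "(axis l 1, b) = X 0" by blast
    have "fst (X 0) = axis l 1" unfolding X(2)[symmetric] by simp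
    then show ?thesis using X(1) by blast
  qed
  then obtain X where X: "\<And>l. X l \<in> lie_algebra M d \<rho> 0" "\<And>l. fst (X l 0) = axis l 1"
    by metis
  have u: "smooth_near u" using flat[of 0] by simp
  show ?thesis
  proof (rule flat_of_identity_matrix_mult[of "\<lambda>l k Z. fst (X l Z) $ k" "\<lambda>k. d_Z k u"])
    show "smooth_near (\<lambda>Z. fst (X l Z) $ k)" for l k
      using smooth_near_vf_coeff[OF lie_algebra_smooth_near[OF X(1)], of l "Inl k"] by simp
    show "smooth_near (d_Z k u)" for k
      using smooth_near_wirtinger[OF u, of "Inl k"] by simp
    have "\<forall>\<^sub>F Z in nhds 0. Z \<in> S" using assms(2,3) by (rule eventually_nhds_in_open)
    then have "\<forall>\<^sub>F Z in nhds 0. vf_apply (X l) u Z = (\<Sum>k\<in>UNIV. fst (X l Z) $ k * d_Z k u Z)" for l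
      by eventually_elim (simp add: vf_apply_def d_Z_holomorphic(2)[OF assms(4)])
    then show "flat fields n (\<lambda>Z. \<Sum>k\<in>UNIV. fst (X l Z) $ k * d_Z k u Z)" for l
      by (rule flat_cong) (rule flat_vf_apply_lie_algebra[OF X(1) flat])
  qed (simp add: X(2) axis_def)
qed

lemma flat_holomorphic_zero:
  assumes ft: "finite_type_at M d \<rho> 0" and S: "open S" "0 \<in> S" "holomorphic_map_on (*s) (*) u S"
    and flat: "\<And>n. flat fields n u"
  shows "\<forall>\<^sub>F Z in nhds 0. u Z = 0"
proof (rule holomorphic_zero_if_derivatives_closed[OF _ _ _ S(1,2)])
  let ?\<F> = "{u. holomorphic_map_on (*s) (*) u S \<and> (\<forall>n. flat fields n u)}"
  fix u assume u: "u \<in> ?\<F>"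
  have "flat fields 1 u" using u by blast
  then show "u 0 = 0" by simp
  fix v :: "complex^'n"
  have "\<forall>\<^sub>F Z in nhds 0. Z \<in> S" using S(1,2) by (rule eventually_nhds_in_open)
  then have "\<forall>\<^sub>F Z in nhds 0. (\<Sum>k\<in>UNIV. v $ k * d_Z k u Z) = frechet_derivative u (at Z) v"
  proof eventually_elim
    case (elim Z)
    then have *: "u differentiable (at Z)"
      "\<And>c v. frechet_derivative u (at Z) (c *s v) = c * frechet_derivative u (at Z) v"
      using u unfolding vec_structure.holomorphic_map_on_iff by blast+
    have "frechet_derivative u (at Z) v = frechet_derivative u (at Z) (\<Sum>k\<in>UNIV. v $ k *s axis k 1)"
      by (simp add: basis_expansion)
    then show ?case
      using u d_Z_holomorphic(1)[OF _ elim, of u]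
      by (simp add: linear_sum[OF linear_frechet_derivative[OF *(1)]] *(2))
  qed
  moreover have "flat fields n (\<lambda>Z. \<Sum>k\<in>UNIV. v $ k * d_Z k u Z)" for n
    using flat_d_Z[OF ft S(1,2)] u by (intro flat_sum flat_mult smooth_near_const) auto
  ultimately have "flat fields n (\<lambda>Z. frechet_derivative u (at Z) v)" for n
    by (rule flat_cong)
  then show "(\<lambda>Z. frechet_derivative u (at Z) v) \<in> ?\<F>"
    using u vec_structure.holomorphic_map_on_directional_derivative[OF S(1)] by blast
qed (use assms in auto)

text \<open>If a combination \<open>P h + R g\<close> with \<open>P\<close> the identity at 0 vanishes on \<open>M\<close>, then differentiating
  it along a field that annihilates \<open>g\<close> on \<open>M\<close> expresses \<open>P (X h)\<close> through \<open>h\<close> and \<open>g\<close> themselves.\<close>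

lemma flat_vf_apply_of_relation:
  fixes P R :: "'k::finite \<Rightarrow> 'k \<Rightarrow> complex^'n \<Rightarrow> complex"
  assumes P: "\<And>i k. smooth_near (P i k)" "\<And>i k. P i k 0 = (if i = k then 1 else 0)"
    and R: "\<And>i k. smooth_near (R i k)"
    and rel: "\<And>i. \<forall>\<^sub>F Z in nhds 0. Z \<in> M \<longrightarrow> (\<Sum>k\<in>UNIV. P i k Z * h k Z + R i k Z * g k Z) = 0"
    and flat: "\<And>k. flat fields n (h k)" "\<And>k. flat fields n (g k)"
    and X: "X \<in> fields" "\<And>k. \<forall>\<^sub>F Z in nhds 0. Z \<in> M \<longrightarrow> vf_apply X (g k) Z = 0"
  shows "flat fields n (vf_apply X (h k))"
proof (rule flat_of_identity_matrix_mult[OF P, of "\<lambda>k. vf_apply X (h k)"])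
  have h: "smooth_near (h k)" and g: "smooth_near (g k)" for k
    using flat flat_imp_smooth_near by blast+
  show "smooth_near (vf_apply X (h k))" for k
    using smooth_near_vf_apply[OF smooth[OF X(1)] h] .
  fix i
  define E where "E = (\<lambda>Z. \<Sum>k\<in>UNIV. P i k Z * h k Z + R i k Z * g k Z)"
  have E: "smooth_near E"
    unfolding E_def using P(1) R h g by (intro smooth_near_sum smooth_near_add smooth_near_mult)
  have "flat fields n (vf_apply X E)"
    using smooth_near_vf_apply[OF smooth[OF X(1)] E] vf_apply_vanishing[OF E _ X(1)] rel[of i]
    by (intro flat_if_vanishing) (simp_all add: E_def)
  moreover have "flat fields n (vf_apply X (g k))" for k
    using smooth_near_vf_apply[OF smooth[OF X(1)] g] X(2) by (rule flat_if_vanishing)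
  then have "flat fields n (\<lambda>Z. \<Sum>k\<in>UNIV. (-1) * (vf_apply X (P i k) Z * h k Z
      + (vf_apply X (R i k) Z * g k Z + R i k Z * vf_apply X (g k) Z)))"
    using flat P(1) R smooth[OF X(1)]
    by (intro flat_sum flat_add flat_mult smooth_near_const smooth_near_vf_apply)
  ultimately have "flat fields n (\<lambda>Z. vf_apply X E Z + (\<Sum>k\<in>UNIV. (-1) * (vf_apply X (P i k) Z * h k Z
      + (vf_apply X (R i k) Z * g k Z + R i k Z * vf_apply X (g k) Z))))"
    by (rule flat_add)
  moreover have "\<forall>\<^sub>F Z in nhds 0. \<forall>k. P i k differentiable (at Z) \<and> R i k differentiable (at Z)
      \<and> h k differentiable (at Z) \<and> g k differentiable (at Z)"
    using P(1) R h g
    by (auto intro!: eventually_all_finite eventually_conj smooth_near_eventually_differentiable)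
  then have "\<forall>\<^sub>F Z in nhds 0. vf_apply X E Z + (\<Sum>k\<in>UNIV. (-1) * (vf_apply X (P i k) Z * h k Z
      + (vf_apply X (R i k) Z * g k Z + R i k Z * vf_apply X (g k) Z)))
      = (\<Sum>k\<in>UNIV. P i k Z * vf_apply X (h k) Z)"
  proof eventually_elim
    case (elim Z)
    have "vf_apply X E Z = (\<Sum>k\<in>UNIV. (P i k Z * vf_apply X (h k) Z + vf_apply X (P i k) Z * h k Z)
        + (R i k Z * vf_apply X (g k) Z + vf_apply X (R i k) Z * g k Z))"
      unfolding E_def using elim by (subst vf_apply_sum) (auto simp: vf_apply_add vf_apply_mult)
    then show ?case by (simp flip: sum.distrib)
  qed
  ultimately show "flat fields n (\<lambda>Z. \<Sum>k\<in>UNIV. P i k Z * vf_apply X (h k) Z)"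
    by (rule flat_cong[rotated])
qed

text \<open>Induction on the order. The two halves of the relation are exchanged by conjugation; fields of
  type \<open>(0,1)\<close> annihilate the holomorphic \<open>h\<close>, and fields of type \<open>(1,0)\<close> annihilate its conjugate.\<close>

lemma flat_of_reflection:
  fixes P R :: "'k::finite \<Rightarrow> 'k \<Rightarrow> complex^'n \<Rightarrow> complex"
  assumes P: "\<And>i k. smooth_near (P i k)" "\<And>i k. P i k 0 = (if i = k then 1 else 0)"
    and R: "\<And>i k. smooth_near (R i k)"
    and rel: "\<And>i. \<forall>\<^sub>F Z in nhds 0. Z \<in> M \<longrightarrow> (\<Sum>k\<in>UNIV. P i k Z * h k Z + R i k Z * cnj (h k Z)) = 0"
    and S: "open S" "0 \<in> S" and hol: "\<And>k. holomorphic_map_on (*s) (*) (h k) S" and h0: "\<And>k. h k 0 = 0"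
  shows "flat fields n (h k) \<and> flat fields n (\<lambda>Z. cnj (h k Z))"
proof (induction n arbitrary: k)
  case 0
  then show ?case
    using holomorphic_imp_smooth_near[OF S hol] by (simp add: smooth_near_cnj)
next
  case (Suc n)
  have h: "smooth_near (h k)" "smooth_near (\<lambda>Z. cnj (h k Z))" for k
    using holomorphic_imp_smooth_near[OF S hol] by (simp_all add: smooth_near_cnj)
  have inS: "\<forall>\<^sub>F Z in nhds 0. Z \<in> S" using S by (rule eventually_nhds_in_open)
  have rel': "\<forall>\<^sub>F Z in nhds 0. Z \<in> M \<longrightarrow>
      (\<Sum>k\<in>UNIV. cnj (P i k Z) * cnj (h k Z) + cnj (R i k Z) * h k Z) = 0" for i
    using rel[of i]
  proof eventually_elim
    case (elim Z)
    have "(\<Sum>k\<in>UNIV. cnj (P i k Z) * cnj (h k Z) + cnj (R i k Z) * h k Z)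
        = cnj (\<Sum>k\<in>UNIV. P i k Z * h k Z + R i k Z * cnj (h k Z))" by simp
    then show ?case using elim by (metis complex_cnj_zero)
  qed
  have "flat fields n (vf_apply X (h k)) \<and> flat fields n (vf_apply X (\<lambda>Z. cnj (h k Z)))"
    if X: "X \<in> fields" for X k
  proof -
    consider "tangent_field_near M d \<rho> 0 {w. snd w = 0} X" | "tangent_field_near M d \<rho> 0 {w. fst w = 0} X"
      using X by (auto simp: tangential_fields_def)
    then show ?thesis
    proof cases
      case 1
      have kill: "\<forall>\<^sub>F Z in nhds 0. Z \<in> M \<longrightarrow> vf_apply X (\<lambda>Z. cnj (h k Z)) Z = 0" for k
        using tangent_field_eventually[OF 1] inS
        by eventually_elim (simp add: vf_apply_def d_Z_holomorphic(3)[OF hol])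
      have "flat fields n (vf_apply X (h k))"
        using flat_vf_apply_of_relation[OF P R rel _ _ X kill] Suc by blast
      then show ?thesis
        using flat_if_vanishing[OF smooth_near_vf_apply[OF smooth[OF X] h(2)] kill] by blast
    next
      case 2
      have kill: "\<forall>\<^sub>F Z in nhds 0. Z \<in> M \<longrightarrow> vf_apply X (h k) Z = 0" for k
        using tangent_field_eventually[OF 2] inS
        by eventually_elim (simp add: vf_apply_def d_Z_holomorphic(2)[OF hol])
      have "flat fields n (vf_apply X (\<lambda>Z. cnj (h k Z)))"
        by (rule flat_vf_apply_of_relation[OF _ _ _ rel' _ _ X kill])
          (use P R Suc in \<open>auto simp: smooth_near_cnj\<close>)
      then show ?thesis
        using flat_if_vanishing[OF smooth_near_vf_apply[OF smooth[OF X] h(1)] kill] by blast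
    qed
  qed
  then show ?case using h h0 by simp
qed

end

section \<open>Comparing two holomorphic maps\<close>

lemma isCont_eventually_mem:
  "isCont f x \<Longrightarrow> open A \<Longrightarrow> f x \<in> A \<Longrightarrow> \<forall>\<^sub>F y in nhds x. f y \<in> A"
  unfolding isCont_def tendsto_at_iff_tendsto_nhds by (rule topological_tendstoD)

lemma (in complex_structure) holomorphic_map_onI:
  assumes "\<And>x. x \<in> S \<Longrightarrow> \<exists>f'. (f has_derivative f') (at x) \<and> (\<forall>c v. f' (s c v) = c * f' v)"
  shows "holomorphic_map_on s (*) f S"
  unfolding holomorphic_map_on_iff
proof
  fix x assume "x \<in> S"
  then obtain f' where f': "(f has_derivative f') (at x)" "\<And>c v. f' (s c v) = c * f' v"
    using assms by blast
  show "f differentiable (at x) \<and>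
      (\<forall>c v. frechet_derivative f (at x) (s c v) = c * frechet_derivative f (at x) v)"
    unfolding frechet_derivative_eqI[OF f'(1)] using f' differentiableI[OF f'(1)] by blast
qed

lemma (in complex_structure) holomorphic_map_on_compose:
  assumes f: "holomorphic_map_on s (*) f N"
    and g: "\<And>x. x \<in> S \<Longrightarrow> g x \<in> N \<and> (\<exists>g'. (g has_derivative g') (at x) \<and> (\<forall>c v. g' (s' c v) = s c (g' v)))"
    and s': "complex_structure s'"
  shows "holomorphic_map_on s' (*) (\<lambda>x. f (g x)) S"
proof -
  interpret source: complex_structure s' by (rule s')
  show ?thesis
  proof (rule source.holomorphic_map_onI)
    fix x assume "x \<in> S"
    then obtain g' where g': "(g has_derivative g') (at x)" "\<And>c v. g' (s' c v) = s c (g' v)"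
      using g by blast
    have f': "(f has_derivative frechet_derivative f (at (g x))) (at (g x))"
      "\<And>c v. frechet_derivative f (at (g x)) (s c v) = c * frechet_derivative f (at (g x)) v"
      using f g[OF \<open>x \<in> S\<close>] unfolding holomorphic_map_on_iff frechet_derivative_works by blast+
    show "\<exists>f'. ((\<lambda>x. f (g x)) has_derivative f') (at x) \<and> (\<forall>c v. f' (s' c v) = c * f' v)"
      using has_derivative_compose[OF g'(1) f'(1)] f'(2) g'(2) by metis
  qed
qed

lemma holomorphic_germ_derivative:
  fixes H :: "complex^'n \<Rightarrow> complex^'m"
  assumes "holomorphic_germ H"
  obtains S where "open S" "0 \<in> S"
    "\<And>Z. Z \<in> S \<Longrightarrow> \<exists>H'. (H has_derivative H') (at Z) \<and> Vector_Spaces.linear (*s) (*s) H'"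
  using assms unfolding holomorphic_germ_def holomorphic_map_on_def by blast

lemma holomorphic_germ_component:
  fixes H :: "complex^'n \<Rightarrow> complex^'m"
  assumes "\<And>Z. Z \<in> S \<Longrightarrow> \<exists>H'. (H has_derivative H') (at Z) \<and> Vector_Spaces.linear (*s) (*s) H'"
  shows "holomorphic_map_on (*s) (*) (\<lambda>Z. H Z $ k) S"
proof (rule vec_structure.holomorphic_map_onI)
  fix Z assume "Z \<in> S"
  then obtain H' where H': "(H has_derivative H') (at Z)" "Vector_Spaces.linear (*s) (*s) H'"
    using assms by blast
  show "\<exists>f'. ((\<lambda>Z. H Z $ k) has_derivative f') (at Z) \<and> (\<forall>c v. f' (c *s v) = c * f' v)"
    using bounded_linear.has_derivative[OF bounded_linear_vec_nth H'(1), of k] H'(2)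
    by (intro exI[of _ "\<lambda>v. H' v $ k"]) (simp add: Vector_Spaces.linear_iff)
qed

text \<open>The complexification of \<open>Z \<mapsto> (H Z, cnj_vec (H Z))\<close>, with \<open>\<zeta>\<close> in the place of \<open>cnj_vec Z\<close>.\<close>

definition double_map :: "(complex^'n \<Rightarrow> complex^'m) \<Rightarrow> (complex^'n) \<times> (complex^'n) \<Rightarrow> (complex^'m) \<times> (complex^'m)"
  where "double_map H p = (H (fst p), cnj_vec (H (cnj_vec (snd p))))"

lemma double_map_derivative:
  fixes H :: "complex^'n \<Rightarrow> complex^'m"
  assumes H: "\<And>Z. Z \<in> S \<Longrightarrow> \<exists>H'. (H has_derivative H') (at Z) \<and> Vector_Spaces.linear (*s) (*s) H'"
    and p: "p \<in> S \<times> cnj_vec ` S"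
  shows "\<exists>D. (double_map H has_derivative D) (at p) \<and> (\<forall>c v. D (pair_scale c v) = pair_scale c (D v))"
proof -
  obtain A where A: "(H has_derivative A) (at (fst p))" "Vector_Spaces.linear (*s) (*s) A"
    using H p by (metis mem_Times_iff)
  have "cnj_vec (snd p) \<in> S" using p by auto
  then obtain B where B: "(H has_derivative B) (at (cnj_vec (snd p)))" "Vector_Spaces.linear (*s) (*s) B"
    using H by metis
  have "((\<lambda>p. H (fst p)) has_derivative (\<lambda>v. A (fst v))) (at p)"
    by (rule has_derivative_compose[OF has_derivative_fst[OF has_derivative_ident] A(1)])
  moreover have "((\<lambda>p. cnj_vec (snd p)) has_derivative (\<lambda>v. cnj_vec (snd v))) (at p)"
    by (intro bounded_linear.has_derivative[OF bounded_linear_cnj_vec] has_derivative_snd has_derivative_ident)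
  from bounded_linear.has_derivative[OF bounded_linear_cnj_vec has_derivative_compose[OF this B(1)]]
  have "((\<lambda>p. cnj_vec (H (cnj_vec (snd p)))) has_derivative (\<lambda>v. cnj_vec (B (cnj_vec (snd v))))) (at p)" .
  ultimately have "(double_map H has_derivative (\<lambda>v. (A (fst v), cnj_vec (B (cnj_vec (snd v)))))) (at p)"
    unfolding double_map_def[abs_def] by (rule has_derivative_Pair)
  moreover have "A (c *s v) = c *s A v" "B (c *s v) = c *s B v" for c v
    using A(2) B(2) by (simp_all add: Vector_Spaces.linear_iff)
  ultimately show ?thesis
    by (intro exI conjI) (auto simp: pair_scale_def cnj_vec_scale)
qed

text \<open>Hadamard's lemma along the segment from \<open>H2\<close> to \<open>H1\<close>. The coefficients are integrals of
  derivatives of \<open>f\<close>; they are holomorphic in \<open>(Z, \<zeta>)\<close>, hence smooth for \<open>\<zeta> = cnj_vec Z\<close>.\<close>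

lemma hadamard_difference:
  fixes H1 H2 :: "complex^'n \<Rightarrow> complex^'m" and f :: "(complex^'m) \<times> (complex^'m) \<Rightarrow> complex"
  assumes "open N" "0 \<in> N" and f: "holomorphic_map_on pair_scale (*) f N"
    and H: "holomorphic_germ H1" "holomorphic_germ H2"
  obtains P R :: "'m \<Rightarrow> complex^'n \<Rightarrow> complex"
  where "\<And>k. smooth_near (P k)" "\<And>k. smooth_near (R k)"
    "\<And>k. P k 0 = frechet_derivative f (at 0) (axis k 1, 0)"
    "\<forall>\<^sub>F Z in nhds 0. f (H1 Z, cnj_vec (H1 Z)) - f (H2 Z, cnj_vec (H2 Z))
      = (\<Sum>k\<in>UNIV. P k Z * (H1 Z - H2 Z) $ k + R k Z * cnj ((H1 Z - H2 Z) $ k))"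
proof -
  obtain S1 where S1: "open S1" "0 \<in> S1"
    "\<And>Z. Z \<in> S1 \<Longrightarrow> \<exists>H'. (H1 has_derivative H') (at Z) \<and> Vector_Spaces.linear (*s) (*s) H'"
    using holomorphic_germ_derivative[OF H(1)] by metis
  obtain S2 where S2: "open S2" "0 \<in> S2"
    "\<And>Z. Z \<in> S2 \<Longrightarrow> \<exists>H'. (H2 has_derivative H') (at Z) \<and> Vector_Spaces.linear (*s) (*s) H'"
    using holomorphic_germ_derivative[OF H(2)] by metis
  define S where "S = S1 \<inter> S2"
  define h1 where "h1 = double_map H1"
  define h2 where "h2 = double_map H2"
  define Dom where "Dom = S \<times> cnj_vec ` S"
  have Dom: "open Dom" "0 \<in> Dom"
    using S1 S2 by (auto simp: Dom_def S_def zero_prod_def image_iff intro!: open_Times open_cnj_vec_image bexI[of _ 0])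
  have deriv: "\<exists>D. (h1 has_derivative D) (at p) \<and> (\<forall>c v. D (pair_scale c v) = pair_scale c (D v))"
    "\<exists>D. (h2 has_derivative D) (at p) \<and> (\<forall>c v. D (pair_scale c v) = pair_scale c (D v))"
    if "p \<in> Dom" for p
    using double_map_derivative[of S H1 p] double_map_derivative[of S H2 p] S1 S2 that
    by (auto simp: Dom_def S_def h1_def h2_def)
  have zero: "h1 0 = 0" "h2 0 = 0"
    using H by (simp_all add: h1_def h2_def double_map_def holomorphic_germ_def zero_prod_def)
  obtain \<epsilon> where \<epsilon>: "0 < \<epsilon>" "ball 0 \<epsilon> \<subseteq> N"
    using assms(1,2) open_contains_ball by blast
  have "isCont h1 0" "isCont h2 0"
    using deriv[OF Dom(2)] has_derivative_continuous by blast+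
  then have "\<forall>\<^sub>F p in nhds 0. h1 p \<in> ball 0 \<epsilon>" "\<forall>\<^sub>F p in nhds 0. h2 p \<in> ball 0 \<epsilon>"
    using \<epsilon>(1) zero by (auto dest!: isCont_eventually_mem[OF _ open_ball, of _ _ 0 \<epsilon>])
  then have "\<forall>\<^sub>F p in nhds 0. p \<in> Dom \<and> h1 p \<in> ball 0 \<epsilon> \<and> h2 p \<in> ball 0 \<epsilon>"
    using eventually_nhds_in_open[OF Dom] by eventually_elim auto
  then obtain W where W: "open W" "0 \<in> W" "\<And>p. p \<in> W \<Longrightarrow> p \<in> Dom"
    "\<And>p. p \<in> W \<Longrightarrow> h1 p \<in> ball 0 \<epsilon> \<and> h2 p \<in> ball 0 \<epsilon>"
    unfolding eventually_nhds by blast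
  define c where "c = (\<lambda>p t. h2 p + t *\<^sub>R (h1 p - h2 p))"
  have c_in: "c p t \<in> N" if "p \<in> W" "t \<in> {0..1}" for p t
  proof -
    have "c p t \<in> ball 0 \<epsilon>"
      using convexD_alt[OF convex_ball, of "h2 p" 0 \<epsilon> "h1 p" t] W(4)[OF that(1)] that(2)
      by (simp add: c_def algebra_simps)
    then show ?thesis using \<epsilon>(2) by blast
  qed
  have cont: "continuous_on W h1" "continuous_on W h2"
    using deriv W(3) has_derivative_continuous by (intro continuous_at_imp_continuous_on; blast)+
  have c_deriv: "\<exists>D. ((\<lambda>p. c p t) has_derivative D) (at p) \<and> (\<forall>a v. D (pair_scale a v) = pair_scale a (D v))"
    if p: "p \<in> W" for p t
  proof -
    obtain D1 D2 where D: "(h1 has_derivative D1) (at p)" "(h2 has_derivative D2) (at p)"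
      "\<And>c v. D1 (pair_scale c v) = pair_scale c (D1 v)" "\<And>c v. D2 (pair_scale c v) = pair_scale c (D2 v)"
      using deriv[OF W(3)[OF p]] by blast
    have "((\<lambda>p. c p t) has_derivative (\<lambda>v. D2 v + t *\<^sub>R (D1 v - D2 v))) (at p)"
      unfolding c_def by (intro has_derivative_add has_derivative_scaleR_right has_derivative_diff D)
    moreover have "D2 (pair_scale a v) + t *\<^sub>R (D1 (pair_scale a v) - D2 (pair_scale a v))
        = pair_scale a (D2 v + t *\<^sub>R (D1 v - D2 v))" for a v
      by (simp add: D pair_structure.add_right pair_structure.diff_right pair_structure.scaleR_right)
    ultimately show ?thesis by blast
  qed
  define Q where "Q = (\<lambda>w p. integral {0..1} (\<lambda>t. frechet_derivative f (at (c p t)) w))"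
  have df: "holomorphic_map_on pair_scale (*) (\<lambda>q. frechet_derivative f (at q) w) N" for w
    by (rule pair_structure.holomorphic_map_on_directional_derivative[OF \<open>open N\<close> f])
  have c_cont: "continuous_on (W \<times> {0..1}) (\<lambda>z. c (fst z) (snd z))"
    unfolding c_def
    by (intro continuous_intros continuous_on_compose2[OF cont(1)] continuous_on_compose2[OF cont(2)]) auto
  have integrand_cont: "continuous_on (W \<times> {0..1}) (\<lambda>(p, t). frechet_derivative f (at (c p t)) w)" for w
    unfolding split_beta
    by (rule continuous_on_compose2[OF pair_structure.holomorphic_map_on_imp_continuous_on[OF df] c_cont])
      (use c_in in auto)
  have Q_hol: "holomorphic_map_on pair_scale (*) (Q w) W" for w
    unfolding Q_def
  proof (rule pair_structure.holomorphic_map_on_integral[OF W(1) integrand_cont])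
    show "holomorphic_map_on pair_scale (*) (\<lambda>p. frechet_derivative f (at (c p t)) w) W"
      if "t \<in> {0..1}" for t
      by (rule pair_structure.holomorphic_map_on_compose[OF df _ pair_structure.complex_structure_axioms])
        (use c_in c_deriv that in blast)
  qed
  define diag where "diag = (\<lambda>Z :: complex^'n. (Z, cnj_vec Z))"
  have diag: "bounded_linear diag"
    unfolding diag_def by (intro bounded_linear_Pair bounded_linear_ident bounded_linear_cnj_vec)
  have diag0: "diag 0 = 0" by (simp add: diag_def zero_prod_def)
  have preimage: "open (diag -` W)" "0 \<in> diag -` W"
    using open_vimage[OF W(1) linear_continuous_on[OF diag]] W(2) diag0 by auto
  have smooth: "smooth_near (\<lambda>Z. Q w (diag Z))" for w
    unfolding smooth_near_def smooth_on_def
    using times_differentiable_on_linear_precomp[OF preimage(1) diag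
        pair_structure.holomorphic_map_on_imp_times_differentiable_on[OF W(1) Q_hol]] preimage by blast
  have difference: "f (h1 p) - f (h2 p) = (\<Sum>k\<in>UNIV.
      Q (axis k 1, 0) p * fst (h1 p - h2 p) $ k + Q (0, axis k 1) p * snd (h1 p - h2 p) $ k)"
    if p: "p \<in> W" for p
  proof -
    have f': "(f has_derivative frechet_derivative f (at q)) (at q)"
      "\<And>a v. frechet_derivative f (at q) (pair_scale a v) = a * frechet_derivative f (at q) v"
      if "q \<in> N" for q
      using f that unfolding pair_structure.holomorphic_map_on_iff frechet_derivative_works by blast+
    define w where "w = h1 p - h2 p"
    have "((\<lambda>t. f (c p t)) has_vector_derivative frechet_derivative f (at (c p t)) w) (at t within {0..1})"
      if t: "t \<in> {0..1}" for t
    proof -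
      have "((\<lambda>t. c p t) has_derivative (\<lambda>t. t *\<^sub>R w)) (at t within {0..1})"
        unfolding c_def w_def by (auto intro!: derivative_eq_intros)
      from has_derivative_compose[OF this f'(1)[OF c_in[OF p t]]] show ?thesis
        unfolding has_vector_derivative_def
        using linear_scale[OF has_derivative_linear[OF f'(1)[OF c_in[OF p t]]]] by simp
    qed
    then have "((\<lambda>t. frechet_derivative f (at (c p t)) w) has_integral f (c p 1) - f (c p 0)) {0..1}"
      by (intro fundamental_theorem_of_calculus) auto
    then have "f (h1 p) - f (h2 p) = integral {0..1} (\<lambda>t. frechet_derivative f (at (c p t)) w)"
      by (simp add: c_def integral_unique)
    also have "\<dots> = integral {0..1} (\<lambda>t. \<Sum>k\<in>UNIV.
        frechet_derivative f (at (c p t)) (axis k 1, 0) * fst w $ k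
        + frechet_derivative f (at (c p t)) (0, axis k 1) * snd w $ k)"
    proof (rule integral_cong)
      fix t :: real assume "t \<in> {0..1}"
      then have q: "c p t \<in> N" using c_in p by blast
      have "w = (\<Sum>k\<in>UNIV. pair_scale (fst w $ k) (axis k 1, 0) + pair_scale (snd w $ k) (0, axis k 1))"
        by (simp add: prod_eq_iff fst_sum snd_sum pair_scale_def basis_expansion)
      then have "frechet_derivative f (at (c p t)) w = frechet_derivative f (at (c p t))
          (\<Sum>k\<in>UNIV. pair_scale (fst w $ k) (axis k 1, 0) + pair_scale (snd w $ k) (0, axis k 1))"
        by simp
      then show "frechet_derivative f (at (c p t)) w = (\<Sum>k\<in>UNIV.
          frechet_derivative f (at (c p t)) (axis k 1, 0) * fst w $ k
          + frechet_derivative f (at (c p t)) (0, axis k 1) * snd w $ k)"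
        by (simp add: linear_sum[OF has_derivative_linear[OF f'(1)[OF q]]]
            linear_add[OF has_derivative_linear[OF f'(1)[OF q]]] f'(2)[OF q] mult.commute)
    qed
    also have "\<dots> = (\<Sum>k\<in>UNIV. Q (axis k 1, 0) p * fst w $ k + Q (0, axis k 1) p * snd w $ k)"
    proof -
      have "(\<lambda>t. frechet_derivative f (at (c p t)) v) integrable_on {0..1}" for v
        using continuous_on_compose2[OF integrand_cont[of v]
            continuous_on_Pair[OF continuous_on_const[of "{0..1}" p] continuous_on_id]] p
        by (intro integrable_continuous_real) auto
      then show ?thesis
        unfolding Q_def
        by (subst integral_sum) (auto simp: integral_add integrable_add integrable_on_mult_left)
    qed
    finally show ?thesis by (simp add: w_def)
  qed
  show ?thesis
  proof (rule that[of "\<lambda>k Z. Q (axis k 1, 0) (diag Z)" "\<lambda>k Z. Q (0, axis k 1) (diag Z)"])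
    show "Q (axis k 1, 0) (diag 0) = frechet_derivative f (at 0) (axis k 1, 0)" for k
      by (simp add: Q_def diag0 c_def zero)
    have "\<forall>\<^sub>F Z in nhds 0. Z \<in> diag -` W" using preimage by (rule eventually_nhds_in_open)
    then show "\<forall>\<^sub>F Z in nhds 0. f (H1 Z, cnj_vec (H1 Z)) - f (H2 Z, cnj_vec (H2 Z))
        = (\<Sum>k\<in>UNIV. Q (axis k 1, 0) (diag Z) * (H1 Z - H2 Z) $ k
          + Q (0, axis k 1) (diag Z) * cnj ((H1 Z - H2 Z) $ k))"
    proof eventually_elim
      case (elim Z)
      then show ?case
        using difference[of "diag Z"] by (simp add: diag_def h1_def h2_def double_map_def)
    qed
  qed (rule smooth)+
qed

section \<open>Coordinates on the target\<close>

text \<open>A basis of \<open>T\<close> is mapped to a spanning set of \<open>T\<close> with at most as many elements, which must then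
  be independent.\<close>

lemma linear_inj_on_of_image_eq:
  fixes A :: "'a::euclidean_space \<Rightarrow> 'a"
  assumes "linear A" "subspace T" "A ` T = T"
  shows "inj_on A T"
proof -
  obtain B where B: "B \<subseteq> T" "independent B" "T \<subseteq> span B" "card B = dim T"
    using basis_exists by blast
  have fin: "finite B" using B(2) independent_imp_finite by blast
  have span: "span B = T" using B(1,3) assms(2) span_minimal by blast
  have "T \<subseteq> span (A ` B)"
    using linear_span_image[OF assms(1), of B] span assms(3) by simp
  moreover have "A ` B \<subseteq> T" using B(1) assms(3) by blast
  moreover have "card (A ` B) \<le> dim T" using card_image_le[OF fin, of A] B(4) by simp
  ultimately have indep: "independent (A ` B)"
    using fin by (intro card_le_dim_spanning) auto
  have "dim T \<le> card (A ` B)"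
    using \<open>T \<subseteq> span (A ` B)\<close> fin by (intro dim_le_card) auto
  then have "inj_on A B"
    using B(4) fin card_image_le[OF fin, of A] by (intro eq_card_imp_inj_on) auto
  then show ?thesis
    using linear_inj_on_span_iff_independent_image[OF assms(1) indep] span by simp
qed

text \<open>Let \<open>T\<close> be the tangent space at 0 of the Segre variety and \<open>A\<close> the differential of \<open>zt\<close> at 0. By
  transversality \<open>A\<close> takes all its values on \<open>T\<close>, and these fill \<open>T\<close>; so \<open>A\<close> is bijective on \<open>T\<close> and
  has a left inverse \<open>B\<close> there. With vectors \<open>e j\<close> dual to the forms \<open>\<partial>\<^sub>Z \<rho>' j\<close>, whose common kernel
  is \<open>T\<close>, every vector is the sum of an element of \<open>T\<close> and a combination of the \<open>e j\<close>. Hence it can be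
  recovered linearly from its values under \<open>A\<close> and the forms, and \<open>\<Theta>\<close> does so for \<open>zt\<close> and \<open>\<rho>'\<close>.\<close>

lemma target_coordinates:
  fixes M' U' :: "(complex^'m) set" and zt :: "complex^'m \<Rightarrow> complex^'m"
  assumes M': "generic_submanifold M' d' \<rho>' U'"
    and zt: "holomorphic_germ zt"
    and submersion: "range (frechet_derivative zt (at 0)) = segre_tangent d' \<rho>' 0 0"
    and transversal:
      "{u + v | u v. frechet_derivative zt (at 0) u = 0 \<and> v \<in> segre_tangent d' \<rho>' 0 0} = UNIV"
  obtains N and \<Theta> :: "'m \<Rightarrow> (complex^'m) \<times> (complex^'m) \<Rightarrow> complex"
  where "open N" "0 \<in> N" "\<And>i. holomorphic_map_on pair_scale (*) (\<Theta> i) N"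
    "\<And>i k. frechet_derivative (\<Theta> i) (at 0) (axis k 1, 0) = (if i = k then 1 else 0)"
    "\<And>i Z W. Z \<in> M' \<inter> U' \<Longrightarrow> W \<in> M' \<inter> U' \<Longrightarrow> zt Z = zt W
      \<Longrightarrow> \<Theta> i (Z, cnj_vec Z) = \<Theta> i (W, cnj_vec W)"
proof -
  interpret target: generic_manifold M' d' \<rho>' U' by unfold_locales (rule M')
  obtain S where S: "open S" "0 \<in> S"
    "\<And>Z. Z \<in> S \<Longrightarrow> \<exists>A. (zt has_derivative A) (at Z) \<and> Vector_Spaces.linear (*s) (*s) A"
    using holomorphic_germ_derivative[OF zt] by metis
  define A where "A = frechet_derivative zt (at 0)"
  have A: "(zt has_derivative A) (at 0)" "Vector_Spaces.linear (*s) (*s) A"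
    using S(3)[OF S(2)] frechet_derivative_eqI unfolding A_def by metis+
  define q where "q = (0 :: complex^'m, cnj_vec 0 :: complex^'m)"
  have "0 \<in> U'" using M' by (simp add: generic_submanifold_def)
  then have q: "q \<in> U' \<times> cnj_vec ` U'" unfolding q_def by (rule target.in_domain)
  define \<alpha> where "\<alpha> = (\<lambda>j. dZ (\<rho>' j) q)"
  have \<alpha>: "linear (\<alpha> j)" "\<alpha> j (c *s v) = c * \<alpha> j v" if "j < d'" for j c v
    using target.linear_dZ[OF that q] by (simp_all add: \<alpha>_def)
  define T where "T = segre_tangent d' \<rho>' 0 0"
  have T_iff: "v \<in> T \<longleftrightarrow> (\<forall>j<d'. \<alpha> j v = 0)" for v
    by (simp add: T_def segre_tangent_def \<alpha>_def q_def)
  have subspace: "vec.subspace T" "subspace T"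
    by (auto simp: vec.subspace_def subspace_def T_iff \<alpha>(2) linear_0[OF \<alpha>(1)] linear_add[OF \<alpha>(1)]
        linear_scale[OF \<alpha>(1)])
  have "A ` T = T"
  proof -
    have "A x \<in> A ` T" for x
    proof -
      have "x \<in> {u + v | u v. A u = 0 \<and> v \<in> T}"
        using transversal by (simp add: A_def T_def)
      then obtain u v where "x = u + v" "A u = 0" "v \<in> T" by blast
      then show ?thesis using linear_add[OF has_derivative_linear[OF A(1)]] by auto
    qed
    then have "range A = A ` T" by blast
    then show ?thesis using submersion by (simp add: A_def T_def)
  qed
  then have "inj_on A T"
    using linear_inj_on_of_image_eq[OF has_derivative_linear[OF A(1)] subspace(2)] by blast
  then obtain B where B: "Vector_Spaces.linear (*s) (*s) B" "\<And>v. v \<in> T \<Longrightarrow> B (A v) = v"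
    using vec.linear_exists_left_inverse_on[OF A(2) subspace(1)] by blast
  have B_simps: "B (x + y) = B x + B y" "B (c *s x) = c *s B x" for x y c
    using B(1) by (simp_all add: Vector_Spaces.linear_iff)
  have A_simps: "A (x + y) = A x + A y" "A (c *s x) = c *s A x" for x y c
    using A(2) by (simp_all add: Vector_Spaces.linear_iff)
  have B_real: "bounded_linear B"
    unfolding linear_linear using B_simps(1) B_simps(2)[of "complex_of_real _"]
    by (intro linearI) (simp_all add: vec_structure.scale_of_real)
  obtain e where e: "\<And>i j. i < d' \<Longrightarrow> j < d' \<Longrightarrow> \<alpha> i (e j) = (if i = j then 1 else 0)"
    using target.dual_vectors[OF q] unfolding \<alpha>_def by blast
  \<comment> \<open>The correction by \<open>B (A (e j))\<close> accounts for the values of \<open>zt\<close> off the Segre variety.\<close>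
  define e' where "e' = (\<lambda>j. e j - B (A (e j)))"
  have identity: "B (A v) + (\<Sum>j<d'. \<alpha> j v *s e' j) = v" for v
  proof -
    interpret BA: linear "\<lambda>v. B (A v)"
      using linear_compose[OF has_derivative_linear[OF A(1)] bounded_linear.linear[OF B_real]]
      by (simp add: o_def)
    define p where "p = v - (\<Sum>j<d'. \<alpha> j v *s e j)"
    have "\<alpha> i p = 0" if "i < d'" for i
    proof -
      have "\<alpha> i p = \<alpha> i v - (\<Sum>j<d'. \<alpha> j v * (if i = j then 1 else 0))"
        unfolding p_def linear_diff[OF \<alpha>(1)[OF that]] linear_sum[OF \<alpha>(1)[OF that]] \<alpha>(2)[OF that]
        using e[OF that] by simp
      then show ?thesis using that by (simp add: if_distrib[of "\<lambda>x. _ * x"] cong: if_cong)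
    qed
    then have "B (A p) = p" using B(2) T_iff by blast
    then have "B (A v) - (\<Sum>j<d'. \<alpha> j v *s B (A (e j))) = v - (\<Sum>j<d'. \<alpha> j v *s e j)"
      unfolding p_def BA.diff BA.sum A_simps B_simps .
    then show ?thesis
      by (simp add: e'_def vec_structure.diff_right sum_subtractf algebra_simps)
  qed
  define \<Theta> where "\<Theta> = (\<lambda>i p. B (zt (fst p)) $ i + (\<Sum>j<d'. \<rho>' j p * e' j $ i))"
  define N where "N = (S \<inter> U') \<times> cnj_vec ` U'"
  have \<Theta>_deriv: "(\<Theta> i has_derivative (\<lambda>v. B (C (fst v)) $ i
      + (\<Sum>j<d'. frechet_derivative (\<rho>' j) (at p) v * e' j $ i))) (at p)"
    if "p \<in> N" "(zt has_derivative C) (at (fst p))" for i p C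
  proof -
    have "((\<lambda>p. B (zt (fst p)) $ i) has_derivative (\<lambda>v. B (C (fst v)) $ i)) (at p)"
      by (intro bounded_linear.has_derivative[OF bounded_linear_vec_nth]
          bounded_linear.has_derivative[OF B_real]
          has_derivative_compose[OF has_derivative_fst[OF has_derivative_ident] that(2)])
    then show ?thesis
      unfolding \<Theta>_def using that(1)
      by (intro has_derivative_add has_derivative_sum has_derivative_mult_left target.has_derivative)
        (auto simp: N_def)
  qed
  show ?thesis
  proof (rule that[of N \<Theta>])
    show "open N" using S(1) target.open_domain by (auto simp: N_def intro!: open_Times open_cnj_vec_image)
    show "0 \<in> N" using S(2) \<open>0 \<in> U'\<close> by (auto simp: N_def zero_prod_def image_iff intro!: bexI[of _ 0])
    show "holomorphic_map_on pair_scale (*) (\<Theta> i) N" for i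
    proof (rule pair_structure.holomorphic_map_onI)
      fix p assume p: "p \<in> N"
      then have p': "fst p \<in> S" "p \<in> U' \<times> cnj_vec ` U'" by (auto simp: N_def)
      obtain C where C: "(zt has_derivative C) (at (fst p))" "Vector_Spaces.linear (*s) (*s) C"
        using S(3)[OF p'(1)] by blast
      have C': "C (c *s v) = c *s C v" for c v using C(2) by (simp add: Vector_Spaces.linear_iff)
      have "frechet_derivative (\<rho>' j) (at p) (pair_scale c v) = c * frechet_derivative (\<rho>' j) (at p) v"
        if "j < d'" for j c v
        using target.derivative_scale[OF that p'(2), of c "fst v" "snd v"] by (simp add: pair_scale_def)
      then have "B (C (fst (pair_scale c v))) $ i
          + (\<Sum>j<d'. frechet_derivative (\<rho>' j) (at p) (pair_scale c v) * e' j $ i)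
          = c * (B (C (fst v)) $ i + (\<Sum>j<d'. frechet_derivative (\<rho>' j) (at p) v * e' j $ i))" for c v
        by (simp add: pair_scale_def C' B_simps(2) distrib_left sum_distrib_left mult.assoc)
      then show "\<exists>f'. (\<Theta> i has_derivative f') (at p) \<and> (\<forall>c v. f' (pair_scale c v) = c * f' v)"
        using \<Theta>_deriv[OF p C(1)] by blast
    qed
    show "frechet_derivative (\<Theta> i) (at 0) (axis k 1, 0) = (if i = k then 1 else 0)" for i k
    proof -
      have "0 \<in> N" by fact
      from frechet_derivative_eqI[OF \<Theta>_deriv[OF this, of A]] A(1)
      have "frechet_derivative (\<Theta> i) (at 0) (axis k 1, 0)
          = (B (A (axis k 1)) + (\<Sum>j<d'. \<alpha> j (axis k 1) *s e' j)) $ i"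
        by (simp add: \<alpha>_def dZ_def q_def zero_prod_def)
      then show ?thesis unfolding identity by (simp add: axis_def)
    qed
    show "\<Theta> i (Z, cnj_vec Z) = \<Theta> i (W, cnj_vec W)"
      if "Z \<in> M' \<inter> U'" "W \<in> M' \<inter> U'" "zt Z = zt W" for i Z W
      using that target.mem_iff[of Z] target.mem_iff[of W] by (simp add: \<Theta>_def)
  qed
qed

section \<open>Unique determination\<close>

theorem corollary1p4:
  fixes M U :: "(complex^'n) set"
    and \<rho> :: "nat \<Rightarrow> (complex^'n) \<times> (complex^'n) \<Rightarrow> complex"
    and M' U' :: "(complex^'m) set"
    and \<rho>' :: "nat \<Rightarrow> (complex^'m) \<times> (complex^'m) \<Rightarrow> complex"
    and d d' :: nat
    and zt :: "complex^'m \<Rightarrow> complex^'m"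
    and H1 H2 :: "complex^'n \<Rightarrow> complex^'m"
  assumes M: "generic_submanifold M d \<rho> U" "0 \<in> M" "finite_type_at M d \<rho> 0"
    and M': "generic_submanifold M' d' \<rho>' U'" "0 \<in> M'"
    and zt: "holomorphic_germ zt" "\<forall>\<^sub>F Z in nhds 0. zt Z \<in> segre d' \<rho>' U' 0"
    and submersion: "range (frechet_derivative zt (at 0)) = segre_tangent d' \<rho>' 0 0"
    and transversal:
      "{u + v | u v. frechet_derivative zt (at 0) u = 0 \<and> v \<in> segre_tangent d' \<rho>' 0 0} = UNIV"
    and H1: "holomorphic_germ H1" "\<forall>\<^sub>F Z in nhds 0. Z \<in> M \<longrightarrow> H1 Z \<in> M'"
    and H2: "holomorphic_germ H2" "\<forall>\<^sub>F Z in nhds 0. Z \<in> M \<longrightarrow> H2 Z \<in> M'"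
    and same: "\<forall>\<^sub>F Z in nhds 0. zt (H1 Z) = zt (H2 Z)"
  shows "\<forall>\<^sub>F Z in nhds 0. H1 Z = H2 Z"
proof -
  interpret manifold_through_0 M d \<rho> U
    using M by unfold_locales
  obtain N and \<Theta> :: "'m \<Rightarrow> (complex^'m) \<times> (complex^'m) \<Rightarrow> complex"
    where N: "open N" "0 \<in> N" and \<Theta>: "\<And>i. holomorphic_map_on pair_scale (*) (\<Theta> i) N"
      "\<And>i k. frechet_derivative (\<Theta> i) (at 0) (axis k 1, 0) = (if i = k then 1 else 0)"
      "\<And>i Z W. Z \<in> M' \<inter> U' \<Longrightarrow> W \<in> M' \<inter> U' \<Longrightarrow> zt Z = zt W
        \<Longrightarrow> \<Theta> i (Z, cnj_vec Z) = \<Theta> i (W, cnj_vec W)"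
    using target_coordinates[OF M'(1) zt(1) submersion transversal] by blast
  define hadamard where "hadamard = (\<lambda>i P R.
      (\<forall>k. smooth_near (P k) \<and> smooth_near (R k) \<and> P k 0 = (if i = k then 1 else 0))
      \<and> (\<forall>\<^sub>F Z in nhds 0. \<Theta> i (H1 Z, cnj_vec (H1 Z)) - \<Theta> i (H2 Z, cnj_vec (H2 Z))
        = (\<Sum>k\<in>UNIV. P k Z * (H1 Z - H2 Z) $ k + R k Z * cnj ((H1 Z - H2 Z) $ k))))"
  have "\<exists>P R. hadamard i P R" for i
  proof (rule hadamard_difference[OF N \<Theta>(1)[of i] H1(1) H2(1)])
    fix P R :: "'m \<Rightarrow> complex^'n \<Rightarrow> complex"
    assume "\<And>k. smooth_near (P k)" "\<And>k. smooth_near (R k)"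
      "\<And>k. P k 0 = frechet_derivative (\<Theta> i) (at 0) (axis k 1, 0)"
      "\<forall>\<^sub>F Z in nhds 0. \<Theta> i (H1 Z, cnj_vec (H1 Z)) - \<Theta> i (H2 Z, cnj_vec (H2 Z))
        = (\<Sum>k\<in>UNIV. P k Z * (H1 Z - H2 Z) $ k + R k Z * cnj ((H1 Z - H2 Z) $ k))"
    then have "hadamard i P R" unfolding hadamard_def \<Theta>(2) by blast
    then show ?thesis by blast
  qed
  then obtain P R where PR: "\<And>i. hadamard i (P i) (R i)" by metis
  have P: "smooth_near (P i k)" "P i k 0 = (if i = k then 1 else 0)" and R: "smooth_near (R i k)"
    and difference: "\<forall>\<^sub>F Z in nhds 0. \<Theta> i (H1 Z, cnj_vec (H1 Z)) - \<Theta> i (H2 Z, cnj_vec (H2 Z))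
        = (\<Sum>k\<in>UNIV. P i k Z * (H1 Z - H2 Z) $ k + R i k Z * cnj ((H1 Z - H2 Z) $ k))" for i k
    using PR[of i] unfolding hadamard_def by blast+
  have U': "open U'" "0 \<in> U'" using M'(1) by (simp_all add: generic_submanifold_def)
  have in_U': "\<forall>\<^sub>F Z in nhds 0. H Z \<in> U'" if H: "holomorphic_germ H" for H :: "complex^'n \<Rightarrow> complex^'m"
  proof -
    have "isCont H 0"
      using holomorphic_germ_derivative[OF H] has_derivative_continuous by metis
    moreover have "H 0 = 0" using H by (simp add: holomorphic_germ_def)
    ultimately show ?thesis
      using isCont_eventually_mem U' by metis
  qed
  have rel: "\<forall>\<^sub>F Z in nhds 0. Z \<in> M \<longrightarrow>
      (\<Sum>k\<in>UNIV. P i k Z * (H1 Z - H2 Z) $ k + R i k Z * cnj ((H1 Z - H2 Z) $ k)) = 0" for i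
    using difference[of i] in_U'[OF H1(1)] in_U'[OF H2(1)] H1(2) H2(2) same
  proof eventually_elim
    case (elim Z)
    then show ?case using \<Theta>(3)[of "H1 Z" "H2 Z" i] by (metis IntI right_minus_eq)
  qed
  obtain S1 where S1: "open S1" "0 \<in> S1"
    "\<And>Z. Z \<in> S1 \<Longrightarrow> \<exists>H'. (H1 has_derivative H') (at Z) \<and> Vector_Spaces.linear (*s) (*s) H'"
    using holomorphic_germ_derivative[OF H1(1)] by metis
  obtain S2 where S2: "open S2" "0 \<in> S2"
    "\<And>Z. Z \<in> S2 \<Longrightarrow> \<exists>H'. (H2 has_derivative H') (at Z) \<and> Vector_Spaces.linear (*s) (*s) H'"
    using holomorphic_germ_derivative[OF H2(1)] by metis
  define S where "S = S1 \<inter> S2"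
  have S: "open S" "0 \<in> S" using S1 S2 by (auto simp: S_def)
  have hol: "holomorphic_map_on (*s) (*) (\<lambda>Z. (H1 Z - H2 Z) $ k) S" for k
  proof (rule holomorphic_germ_component)
    fix Z assume "Z \<in> S"
    then obtain A B where AB: "(H1 has_derivative A) (at Z)" "Vector_Spaces.linear (*s) (*s) A"
      "(H2 has_derivative B) (at Z)" "Vector_Spaces.linear (*s) (*s) B"
      using S1(3) S2(3) unfolding S_def by (metis IntE)
    show "\<exists>H'. ((\<lambda>Z. H1 Z - H2 Z) has_derivative H') (at Z) \<and> Vector_Spaces.linear (*s) (*s) H'"
      using has_derivative_diff[OF AB(1,3)] vec.linear_compose_sub[OF AB(2,4)] by blast
  qed
  have "(H1 0 - H2 0) $ k = 0" for k
    using H1(1) H2(1) by (simp add: holomorphic_germ_def)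
  then have "flat fields n (\<lambda>Z. (H1 Z - H2 Z) $ k)" for n k
    using flat_of_reflection[OF P R rel S hol] by blast
  then have "\<forall>\<^sub>F Z in nhds 0. (H1 Z - H2 Z) $ k = 0" for k
    using flat_holomorphic_zero[OF M(3) S hol] by blast
  then have "\<forall>\<^sub>F Z in nhds 0. \<forall>k. (H1 Z - H2 Z) $ k = 0"
    by (rule eventually_all_finite)
  then show ?thesis
    by eventually_elim (simp add: vec_eq_iff)
qed

end
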